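(* Let $(W,S)$ be a Coxeter system. Let $\equiv$ be the equivalence relation on $\mathcal{F}(W,S)$ defined as the transitive closure of the binary relation $\equiv_0$ given by: $Y\equiv_0 Z$ if there exists $X\in\mathcal{F}(W,S)$ such that $Z=\omega_X\,Y\,\omega_X$ in $W$. Denote by $m$ the number of equivalence classes of $\equiv$ on $\mathcal{F}(W,S)$. Then: (1) The abelianisation of $C(W,S)$ is isomorphic to $\mathbb{Z}_2^m$ (where $\mathbb{Z}_2=\mathbb{Z}/2\mathbb{Z}$). (2) Any generating set of $C(W,S)$ possesses at least $m$ elements. (3) If $\Lambda\subseteq\mathcal{F}(W,S)$ is a transversal for $\equiv$ (that is, contains exactly one element of each equivalence class), then $C(W,S)$ possesses a finite presentation with generating set $C_\Lambda=\{c_X\mid X\in\Lambda\}$.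
   Context: A Coxeter matrix on a finite set $S$ is a symmetric matrix $(m_{s,t})_{s,t\in S}$ with diagonal entries $1$ and off-diagonal entries in $\mathbb{N}_{\ge 2}\cup\{\infty\}$. The associated Coxeter group is $W=\langle S\mid s^2=1;\ Prod(t,s,m_{s,t})=Prod(s,t,m_{s,t})$ for $s\ne t$ in $S$ with $m_{s,t}\neq\infty\rangle$, where $Prod(s,t,m)$ is the word $sts\cdots$ with $m$ letters; $(W,S)$ is the associated Coxeter system ($S$ is always finite). For $X\subseteq S$, $W_X$ is the subgroup of $W$ generated by $X$; $(W_X,X)$ is a Coxeter system. $W_X$ (or $X$) is called irreducible if there is no partition of $X$ into two non-empty subsets $X_1,X_2$ with $m_{s,t}=2$ for all $s\in X_1,t\in X_2$. $\mathcal{F}=\mathcal{F}(W,S)$ denotes the set of non-empty subsets $X\subseteq S$ such that $W_X$ is finite and irreducible. For $X\in\mathcal{F}$, $\omega_X$ is the unique element $\ne 1$ of $W_X$ that permutes $X$ by conjugation; it has order $2$. For $X,Y\in\mathcal{F}$ write $\omega_X(Y)=\omega_XY\omega_X$. For $X\in\mathcal{F}$ set $\Omega_0(X)=\{Y\in\mathcal{F}\mid Y\subsetneq X\}$ and $\Omega_1(X)=\{Y\in\mathcal{F}\mid Y\cup X\text{ is not irreducible}\}$. For $Y\in\Omega_0(X)$ one has $\omega_X(Y)\in\Omega_0(X)$. The cactus group $C(W,S)$ is the group with generators $c_X$, $X\in\mathcal{F}$, and relations: $(R_1)$ $c_X^2=1$ for $X\in\mathcal{F}$; $(R_2)$ $c_Xc_Y=c_{\omega_X(Y)}c_X$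 for $X\in\mathcal{F}$, $Y\in\Omega_0(X)$; $(R_3)$ $c_Yc_X=c_Xc_Y$ for $X\in\mathcal{F}$, $Y\in\Omega_1(X)$. *)

theory Defs
  imports "HOL-Algebra.Generated_Groups" "HOL-Algebra.Product_Groups" "HOL-Library.Extended_Nat"
begin

section \<open>Group presentations\<close>

datatype 'a letter = Gen 'a | Inv 'a

definition words :: "'a set \<Rightarrow> 'a letter list set" where
  "words A = lists (Gen ` A \<union> Inv ` A)"

text \<open>A relation \<open>u = v\<close> between words is encoded as the pair \<open>(u, v)\<close>; pairs whose components are
  not words over the generators are ignored.\<close>

inductive word_eq :: "'a set \<Rightarrow> ('a letter list \<times> 'a letter list) set
    \<Rightarrow> 'a letter list \<Rightarrow> 'a letter list \<Rightarrow> bool" for A R where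
  rel: "(u, v) \<in> R \<Longrightarrow> u \<in> words A \<Longrightarrow> v \<in> words A \<Longrightarrow> word_eq A R u v"
| cancel_right: "a \<in> A \<Longrightarrow> word_eq A R [Gen a, Inv a] []"
| cancel_left: "a \<in> A \<Longrightarrow> word_eq A R [Inv a, Gen a] []"
| embed: "word_eq A R u v \<Longrightarrow> p \<in> words A \<Longrightarrow> q \<in> words A \<Longrightarrow> word_eq A R (p @ u @ q) (p @ v @ q)"
| refl: "u \<in> words A \<Longrightarrow> word_eq A R u u"
| sym: "word_eq A R u v \<Longrightarrow> word_eq A R v u"
| trans: "word_eq A R u v \<Longrightarrow> word_eq A R v w \<Longrightarrow> word_eq A R u w"

definition word_class :: "'a set \<Rightarrow> ('a letter list \<times> 'a letter list) set
    \<Rightarrow> 'a letter list \<Rightarrow> 'a letter list set" where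
  "word_class A R u = {v. word_eq A R u v}"

definition presented_group :: "'a set \<Rightarrow> ('a letter list \<times> 'a letter list) set
    \<Rightarrow> 'a letter list set monoid" where
  "presented_group A R =
    \<lparr>carrier = word_class A R ` words A,
     monoid.mult = (\<lambda>U V. \<Union>u\<in>U. \<Union>v\<in>V. word_class A R (u @ v)),
     one = word_class A R []\<rparr>"

text \<open>\<open>G\<close> has the presentation \<open>\<langle>A | R\<rangle>\<close> on its own elements \<open>A\<close>: the isomorphism is the one
  that is the identity on generators.\<close>

definition has_presentation :: "('a, 'b) monoid_scheme \<Rightarrow> 'a set
    \<Rightarrow> ('a letter list \<times> 'a letter list) set \<Rightarrow> bool" where
  "has_presentation G A R \<longleftrightarrow>
    group G \<and> A \<subseteq> carrier G \<and> R \<subseteq> words A \<times> words A \<and>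
    (\<exists>\<phi> \<in> iso (presented_group A R) G. \<forall>a\<in>A. \<phi> (word_class A R [Gen a]) = a)"

definition has_finite_presentation_on :: "('a, 'b) monoid_scheme \<Rightarrow> 'a set \<Rightarrow> bool" where
  "has_finite_presentation_on G A \<longleftrightarrow> finite A \<and> (\<exists>R. finite R \<and> has_presentation G A R)"

lemma word_eq_words: "word_eq A R u v \<Longrightarrow> u \<in> words A \<and> v \<in> words A"
  by (induction rule: word_eq.induct) (auto simp: words_def)

lemma word_class_eq_iff:
  assumes "v \<in> words A"
  shows "word_class A R u = word_class A R v \<longleftrightarrow> word_eq A R u v"
proof
  assume eq: "word_class A R u = word_class A R v"
  have "v \<in> word_class A R v"
    unfolding word_class_def using assms by (simp add: word_eq.refl)
  then have "v \<in> word_class A R u" by (simp only: eq)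
  then show "word_eq A R u v" by (simp add: word_class_def)
next
  assume uv: "word_eq A R u v"
  have "word_eq A R u w \<longleftrightarrow> word_eq A R v w" for w
    using word_eq.trans[OF uv] word_eq.trans[OF word_eq.sym[OF uv]] by blast
  then show "word_class A R u = word_class A R v" by (simp add: word_class_def)
qed

lemma word_eq_append:
  assumes "word_eq A R u u'" "word_eq A R v v'"
  shows "word_eq A R (u @ v) (u' @ v')"
proof -
  have nil: "[] \<in> words A" by (simp add: words_def)
  note w = word_eq_words[OF assms(1)] word_eq_words[OF assms(2)]
  have "word_eq A R ([] @ u @ v) ([] @ u' @ v)"
    using word_eq.embed[OF assms(1) nil] w by blast
  moreover have "word_eq A R (u' @ v @ []) (u' @ v' @ [])"
    using word_eq.embed[OF assms(2) _ nil] w by blast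
  ultimately have "word_eq A R (u @ v) (u' @ v)" "word_eq A R (u' @ v) (u' @ v')" by simp_all
  then show ?thesis by (rule word_eq.trans)
qed

lemma mult_word_class:
  assumes "u \<in> words A" "v \<in> words A"
  shows "word_class A R u \<otimes>\<^bsub>presented_group A R\<^esub> word_class A R v = word_class A R (u @ v)"
proof -
  have eq: "word_class A R (u' @ v') = word_class A R (u @ v)"
    if "u' \<in> word_class A R u" "v' \<in> word_class A R v" for u' v'
  proof -
    have "word_eq A R (u @ v) (u' @ v')"
      using that unfolding word_class_def mem_Collect_eq by (rule word_eq_append)
    then have "word_class A R (u @ v) = word_class A R (u' @ v')"
      using word_class_eq_iff word_eq_words by (metis (no_types))
    then show ?thesis ..
  qed
  have mem: "u \<in> word_class A R u" "v \<in> word_class A R v"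
    unfolding word_class_def mem_Collect_eq using assms by (auto intro: word_eq.refl)
  show ?thesis
    unfolding presented_group_def monoid.simps
  proof (rule equalityI; rule subsetI)
    fix w
    assume "w \<in> (\<Union>u'\<in>word_class A R u. \<Union>v'\<in>word_class A R v. word_class A R (u' @ v'))"
    then show "w \<in> word_class A R (u @ v)" using eq by blast
  next
    fix w
    assume "w \<in> word_class A R (u @ v)"
    then show "w \<in> (\<Union>u'\<in>word_class A R u. \<Union>v'\<in>word_class A R v. word_class A R (u' @ v'))"
      using mem by blast
  qed
qed

lemma group_presented_group: "group (presented_group A R)"
proof (rule groupI)
  let ?G = "presented_group A R"
  have car: "carrier ?G = word_class A R ` words A" and one: "\<one>\<^bsub>?G\<^esub> = word_class A R []"
    by (simp_all add: presented_group_def)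
  have app: "u @ v \<in> words A" if "u \<in> words A" "v \<in> words A" for u v
    using that by (auto simp: words_def)
  have nil: "[] \<in> words A" by (simp add: words_def)
  show "x \<otimes>\<^bsub>?G\<^esub> y \<in> carrier ?G" if "x \<in> carrier ?G" "y \<in> carrier ?G" for x y
    using that by (auto simp: car mult_word_class app)
  show "\<one>\<^bsub>?G\<^esub> \<in> carrier ?G" by (auto simp: car one nil)
  show "x \<otimes>\<^bsub>?G\<^esub> y \<otimes>\<^bsub>?G\<^esub> z = x \<otimes>\<^bsub>?G\<^esub> (y \<otimes>\<^bsub>?G\<^esub> z)"
    if "x \<in> carrier ?G" "y \<in> carrier ?G" "z \<in> carrier ?G" for x y z
    using that by (auto simp: car mult_word_class app)
  show "\<one>\<^bsub>?G\<^esub> \<otimes>\<^bsub>?G\<^esub> x = x" if "x \<in> carrier ?G" for x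
    using that by (auto simp: car one mult_word_class nil)
  have "\<exists>v \<in> words A. word_eq A R (v @ u) []" if "u \<in> words A" for u
    using that
  proof (induction u)
    case Nil
    show ?case using word_eq.refl[OF nil] nil by (metis append_Nil)
  next
    case (Cons x u)
    then have u: "u \<in> words A" by (simp add: words_def)
    with Cons.IH obtain v where v: "v \<in> words A" "word_eq A R (v @ u) []" by blast
    from Cons.prems have "x \<in> Gen ` A \<union> Inv ` A" by (simp add: words_def)
    then obtain y where y: "[y] \<in> words A" "word_eq A R [y, x] []"
    proof
      assume "x \<in> Gen ` A"
      then obtain a where "a \<in> A" "x = Gen a" by blast
      then show thesis
        using that[of "Inv a"] by (simp add: words_def word_eq.cancel_left)
    next
      assume "x \<in> Inv ` A"
      then obtain a where "a \<in> A" "x = Inv a" by blast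
      then show thesis
        using that[of "Gen a"] by (simp add: words_def word_eq.cancel_right)
    qed
    have "word_eq A R (v @ [y, x] @ u) (v @ [] @ u)"
      using word_eq.embed[OF y(2) v(1) u] .
    then have "word_eq A R ((v @ [y]) @ x # u) (v @ u)" by simp
    then have "word_eq A R ((v @ [y]) @ x # u) []" using v(2) by (rule word_eq.trans)
    with app[OF v(1) y(1)] show ?case by blast
  qed
  note left_inv = this
  show "\<exists>y\<in>carrier ?G. y \<otimes>\<^bsub>?G\<^esub> x = \<one>\<^bsub>?G\<^esub>" if x: "x \<in> carrier ?G" for x
  proof -
    obtain u where u: "u \<in> words A" "x = word_class A R u" using x car by auto
    obtain v where v: "v \<in> words A" "word_eq A R (v @ u) []" using left_inv[OF u(1)] by blast
    have "word_class A R v \<otimes>\<^bsub>?G\<^esub> x = word_class A R (v @ u)"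
      unfolding u(2) by (rule mult_word_class[OF v(1) u(1)])
    also have "\<dots> = \<one>\<^bsub>?G\<^esub>"
      unfolding one using word_class_eq_iff[OF nil] v(2) by blast
    finally show ?thesis using v(1) car by blast
  qed
qed


section \<open>Coxeter systems\<close>

definition coxeter_matrix :: "'a set \<Rightarrow> ('a \<Rightarrow> 'a \<Rightarrow> enat) \<Rightarrow> bool" where
  "coxeter_matrix S M \<longleftrightarrow>
    (\<forall>s\<in>S. \<forall>t\<in>S. M s t = M t s) \<and> (\<forall>s\<in>S. M s s = 1) \<and>
    (\<forall>s\<in>S. \<forall>t\<in>S. s \<noteq> t \<longrightarrow> 2 \<le> M s t)"

fun alternating_word :: "'a \<Rightarrow> 'a \<Rightarrow> nat \<Rightarrow> 'a letter list" where
  "alternating_word s t 0 = []"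
| "alternating_word s t (Suc k) = Gen s # alternating_word t s k"

definition coxeter_relations ::
    "'a set \<Rightarrow> ('a \<Rightarrow> 'a \<Rightarrow> enat) \<Rightarrow> ('a letter list \<times> 'a letter list) set" where
  "coxeter_relations S M =
    {([Gen s, Gen s], []) | s. s \<in> S} \<union>
    {(alternating_word t s k, alternating_word s t k) | s t k.
       s \<in> S \<and> t \<in> S \<and> s \<noteq> t \<and> M s t = enat k}"

text \<open>As usual, \<open>S\<close> is regarded as a subset of \<open>W\<close>, so that subsets of \<open>S\<close> can be conjugated
  in \<open>W\<close>.\<close>

definition coxeter_system :: "('a, 'b) monoid_scheme \<Rightarrow> 'a set \<Rightarrow> ('a \<Rightarrow> 'a \<Rightarrow> enat) \<Rightarrow> bool" where
  "coxeter_system W S M \<longleftrightarrow>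
    finite S \<and> coxeter_matrix S M \<and> has_presentation W S (coxeter_relations S M)"

definition coxeter_irreducible :: "('a \<Rightarrow> 'a \<Rightarrow> enat) \<Rightarrow> 'a set \<Rightarrow> bool" where
  "coxeter_irreducible M X \<longleftrightarrow>
    \<not> (\<exists>X1 X2. X1 \<noteq> {} \<and> X2 \<noteq> {} \<and> X1 \<inter> X2 = {} \<and> X1 \<union> X2 = X \<and>
         (\<forall>s\<in>X1. \<forall>t\<in>X2. M s t = 2))"

text \<open>The parabolic subgroup \<open>W\<^sub>X\<close> is \<^term>\<open>generate W X\<close>.\<close>

definition finite_irreducible_subsets ::
    "('a, 'b) monoid_scheme \<Rightarrow> 'a set \<Rightarrow> ('a \<Rightarrow> 'a \<Rightarrow> enat) \<Rightarrow> 'a set set" where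
  "finite_irreducible_subsets W S M =
    {X. X \<noteq> {} \<and> X \<subseteq> S \<and> finite (generate W X) \<and> coxeter_irreducible M X}"

definition omega :: "('a, 'b) monoid_scheme \<Rightarrow> 'a set \<Rightarrow> 'a" where
  "omega W X = (THE w. w \<in> generate W X \<and> w \<noteq> \<one>\<^bsub>W\<^esub> \<and>
     (\<lambda>x. w \<otimes>\<^bsub>W\<^esub> x \<otimes>\<^bsub>W\<^esub> inv\<^bsub>W\<^esub> w) ` X = X)"

definition omega_conj :: "('a, 'b) monoid_scheme \<Rightarrow> 'a set \<Rightarrow> 'a set \<Rightarrow> 'a set" where
  "omega_conj W X Y = (\<lambda>y. omega W X \<otimes>\<^bsub>W\<^esub> y \<otimes>\<^bsub>W\<^esub> omega W X) ` Y"


section \<open>The cactus group\<close>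

definition Omega0 ::
    "('a, 'b) monoid_scheme \<Rightarrow> 'a set \<Rightarrow> ('a \<Rightarrow> 'a \<Rightarrow> enat) \<Rightarrow> 'a set \<Rightarrow> 'a set set" where
  "Omega0 W S M X = {Y \<in> finite_irreducible_subsets W S M. Y \<subset> X}"

definition Omega1 ::
    "('a, 'b) monoid_scheme \<Rightarrow> 'a set \<Rightarrow> ('a \<Rightarrow> 'a \<Rightarrow> enat) \<Rightarrow> 'a set \<Rightarrow> 'a set set" where
  "Omega1 W S M X = {Y \<in> finite_irreducible_subsets W S M. \<not> coxeter_irreducible M (Y \<union> X)}"

definition cactus_relations :: "('a, 'b) monoid_scheme \<Rightarrow> 'a set \<Rightarrow> ('a \<Rightarrow> 'a \<Rightarrow> enat)
    \<Rightarrow> ('a set letter list \<times> 'a set letter list) set" where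
  "cactus_relations W S M =
    {([Gen X, Gen X], []) | X. X \<in> finite_irreducible_subsets W S M} \<union>
    {([Gen X, Gen Y], [Gen (omega_conj W X Y), Gen X]) | X Y.
       X \<in> finite_irreducible_subsets W S M \<and> Y \<in> Omega0 W S M X} \<union>
    {([Gen Y, Gen X], [Gen X, Gen Y]) | X Y.
       X \<in> finite_irreducible_subsets W S M \<and> Y \<in> Omega1 W S M X}"

definition cactus_group :: "('a, 'b) monoid_scheme \<Rightarrow> 'a set \<Rightarrow> ('a \<Rightarrow> 'a \<Rightarrow> enat)
    \<Rightarrow> 'a set letter list set monoid" where
  "cactus_group W S M =
    presented_group (finite_irreducible_subsets W S M) (cactus_relations W S M)"

definition cactus_gen :: "('a, 'b) monoid_scheme \<Rightarrow> 'a set \<Rightarrow> ('a \<Rightarrow> 'a \<Rightarrow> enat)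
    \<Rightarrow> 'a set \<Rightarrow> 'a set letter list set" where
  "cactus_gen W S M X =
    word_class (finite_irreducible_subsets W S M) (cactus_relations W S M) [Gen X]"

definition cactus_equiv0 :: "('a, 'b) monoid_scheme \<Rightarrow> 'a set \<Rightarrow> ('a \<Rightarrow> 'a \<Rightarrow> enat)
    \<Rightarrow> ('a set \<times> 'a set) set" where
  "cactus_equiv0 W S M =
    {(Y, Z). Y \<in> finite_irreducible_subsets W S M \<and> Z \<in> finite_irreducible_subsets W S M \<and>
       (\<exists>X \<in> finite_irreducible_subsets W S M. Z = omega_conj W X Y)}"

definition cactus_equiv :: "('a, 'b) monoid_scheme \<Rightarrow> 'a set \<Rightarrow> ('a \<Rightarrow> 'a \<Rightarrow> enat)
    \<Rightarrow> ('a set \<times> 'a set) set" where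
  "cactus_equiv W S M = (cactus_equiv0 W S M)\<^sup>+"

definition transversal :: "'a set \<Rightarrow> ('a \<times> 'a) set \<Rightarrow> 'a set \<Rightarrow> bool" where
  "transversal A r L \<longleftrightarrow> L \<subseteq> A \<and> (\<forall>C \<in> A // r. \<exists>!x. x \<in> L \<and> x \<in> C)"

definition abelianisation :: "('a, 'b) monoid_scheme \<Rightarrow> 'a set monoid" where
  "abelianisation G = G Mod derived G (carrier G)"

end

theory Submission
  imports Defs Complex_Main "HOL-Algebra.FiniteProduct"
begin

text \<open>Relation \<open>(R\<^sub>2)\<close> says that \<open>c\<^sub>Y\<close> and \<open>c\<^sub>Z\<close>, with \<open>Z = \<omega>\<^sub>X(Y)\<close> and \<open>Y \<subset> X\<close>, are conjugate by \<open>c\<^sub>X\<close>.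
  If the classes of \<open>\<equiv>\<close> are generated by these conjugations, then the abelianisation is
  generated by one involution for each class.  These \<open>m\<close> involutions are independent: for each class
  the assignment \<open>c\<^sub>Y \<mapsto> 1\<close> for \<open>Y\<close> in the class and \<open>c\<^sub>Y \<mapsto> 0\<close> otherwise respects all relations, so
  there are \<open>m\<close> characters to \<open>\<int>\<^sub>2\<close> that are dual to the classes (\<open>ex_character\<close>).  This gives the
  abelianisation (\<open>abelianisation_iso\<close>), and the \<open>2\<^sup>m\<close> sums of characters are told apart by
  their values on any generating set (\<open>card_generating_set_ge\<close>).

  For the presentation, the conjugating element \<open>c\<^sub>X\<close> belongs to a set \<open>X\<close> that is larger than
  \<open>Y\<close>, while \<open>\<equiv>\<close> preserves cardinality.  Descending induction on the cardinality therefore puts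
  every \<open>c\<^sub>Y\<close> into the subgroup generated by \<open>C\<^sub>\<Lambda>\<close> (\<open>transversal_generates\<close>), and a finitely
  presented group is finitely presented on each of its finite generating sets
  (\<open>finite_presentation_on_generating_set\<close>).

  What remains is that \<open>\<equiv>\<close> involves no other identifications: in its definition \<open>X\<close> need not
  contain \<open>Y\<close>.  If \<open>\<omega>\<^sub>X Y \<omega>\<^sub>X\<close> is contained in \<open>S\<close>, then the elements of \<open>Y - X\<close> are fixed
  by \<open>\<omega>\<^sub>X\<close> and commute with \<open>X\<close>, so irreducibility of \<open>Y\<close> leaves only \<open>Y \<subseteq> X\<close> and the trivial case
  \<open>\<omega>\<^sub>X Y \<omega>\<^sub>X = Y\<close> (\<open>omega_conj_in_FI_cases\<close>).  This and the uniqueness of \<open>\<omega>\<^sub>X\<close> both rest on one fact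
  about an element \<open>w\<close> that conjugates generators \<open>s\<close>, \<open>t\<close> to generators: if \<open>w\<close> is shortened by \<open>t\<close>
  but not by \<open>s\<close>, then \<open>s\<close> and \<open>t\<close> commute and \<open>m\<^sub>s\<^sub>,\<^sub>t = 2\<close> (\<open>conjugation_splits\<close>).  It follows from
  the exchange condition, which comes from counting the reflections of a word modulo \<open>2\<close>, and
  from the dual geometric representation, which shows that \<open>m\<^sub>s\<^sub>,\<^sub>t\<close> can be read off from the group.\<close>

section \<open>Words and presented groups\<close>

lemma Nil_words [simp]: "[] \<in> words A"
  by (simp add: words_def)

lemma append_words [simp]: "u @ v \<in> words A \<longleftrightarrow> u \<in> words A \<and> v \<in> words A"
  by (auto simp: words_def)

lemma Cons_words [simp]: "x # u \<in> words A \<longleftrightarrow> x \<in> Gen ` A \<union> Inv ` A \<and> u \<in> words A"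
  by (auto simp: words_def)

fun letter_val :: "('g, 'm) monoid_scheme \<Rightarrow> ('a \<Rightarrow> 'g) \<Rightarrow> 'a letter \<Rightarrow> 'g" where
  "letter_val G h (Gen a) = h a"
| "letter_val G h (Inv a) = inv\<^bsub>G\<^esub> h a"

definition word_val :: "('g, 'm) monoid_scheme \<Rightarrow> ('a \<Rightarrow> 'g) \<Rightarrow> 'a letter list \<Rightarrow> 'g" where
  "word_val G h u = foldr (\<lambda>x g. letter_val G h x \<otimes>\<^bsub>G\<^esub> g) u \<one>\<^bsub>G\<^esub>"

lemma word_val_Nil [simp]: "word_val G h [] = \<one>\<^bsub>G\<^esub>"
  by (simp add: word_val_def)

lemma word_val_Cons [simp]: "word_val G h (x # u) = letter_val G h x \<otimes>\<^bsub>G\<^esub> word_val G h u"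
  by (simp add: word_val_def)

context group
begin

lemma letter_val_closed:
  assumes "h ` A \<subseteq> carrier G" "x \<in> Gen ` A \<union> Inv ` A"
  shows "letter_val G h x \<in> carrier G"
  using assms by auto

lemma word_val_closed [intro]:
  assumes "h ` A \<subseteq> carrier G" "u \<in> words A"
  shows "word_val G h u \<in> carrier G"
  using assms(2) letter_val_closed[OF assms(1)] by (induction u) auto

lemma word_val_append:
  assumes "h ` A \<subseteq> carrier G" "u \<in> words A" "v \<in> words A"
  shows "word_val G h (u @ v) = word_val G h u \<otimes> word_val G h v"
  using assms(2)
proof (induction u)
  case Nil
  show ?case using word_val_closed[OF assms(1,3)] by simp
next
  case (Cons x u)
  then show ?case
    using word_val_closed[OF assms(1,3)] word_val_closed[OF assms(1), of u]
      letter_val_closed[OF assms(1), of x] by (simp add: m_assoc)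
qed

lemma word_val_in_subgroup:
  assumes "subgroup H G" "h ` A \<subseteq> H" "u \<in> words A"
  shows "word_val G h u \<in> H"
  using assms(3)
proof (induction u)
  case Nil
  show ?case using subgroup.one_closed[OF assms(1)] by simp
next
  case (Cons x u)
  have "letter_val G h x \<in> H"
    using Cons.prems assms(2) subgroup.m_inv_closed[OF assms(1)] by auto
  then show ?case using Cons subgroup.m_closed[OF assms(1)] by simp
qed

lemma generate_eq_word_vals:
  assumes "h ` A \<subseteq> carrier G"
  shows "generate G (h ` A) = word_val G h ` words A"
proof
  show "generate G (h ` A) \<subseteq> word_val G h ` words A"
  proof
    fix x assume "x \<in> generate G (h ` A)"
    then show "x \<in> word_val G h ` words A"
    proof induction
      case one
      show ?case by (rule image_eqI[of _ _ "[]"]) auto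
    next
      case (incl x)
      then obtain a where "a \<in> A" "x = h a" by blast
      then show ?case using assms by (intro image_eqI[of _ _ "[Gen a]"]) auto
    next
      case (inv x)
      then obtain a where "a \<in> A" "x = h a" by blast
      then show ?case using assms by (intro image_eqI[of _ _ "[Inv a]"]) auto
    next
      case (eng x y)
      then obtain u v where "u \<in> words A" "v \<in> words A" "x = word_val G h u" "y = word_val G h v"
        by blast
      then show ?case using word_val_append[OF assms]
        by (intro image_eqI[of _ _ "u @ v"]) auto
    qed
  qed
  show "word_val G h ` words A \<subseteq> generate G (h ` A)"
    using word_val_in_subgroup[OF generate_is_subgroup[OF assms], of h A]
    by (auto intro: generate.incl)
qed

lemma word_val_respects_word_eq:
  assumes h: "h ` A \<subseteq> carrier G"
    and R: "\<And>u v. (u, v) \<in> R \<Longrightarrow> u \<in> words A \<Longrightarrow> v \<in> words A \<Longrightarrow> word_val G h u = word_val G h v"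
    and "word_eq A R u v"
  shows "word_val G h u = word_val G h v"
  using assms(3)
proof induction
  case (embed u v p q)
  then show ?case
    using word_eq_words[OF embed(1)] by (simp add: word_val_append[OF h])
qed (use h R in \<open>auto simp: image_subset_iff\<close>)

end

lemma carrier_presented_group: "carrier (presented_group A R) = word_class A R ` words A"
  by (simp add: presented_group_def)

lemma one_presented_group: "\<one>\<^bsub>presented_group A R\<^esub> = word_class A R []"
  by (simp add: presented_group_def)

lemma inv_word_class_Gen:
  assumes "a \<in> A"
  shows "inv\<^bsub>presented_group A R\<^esub> word_class A R [Gen a] = word_class A R [Inv a]"
proof (rule group.inv_equality[OF group_presented_group])
  have "word_class A R [Inv a, Gen a] = word_class A R []"
    by (subst word_class_eq_iff) (auto intro: word_eq.cancel_left assms)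
  then show "word_class A R [Inv a] \<otimes>\<^bsub>presented_group A R\<^esub> word_class A R [Gen a]
      = \<one>\<^bsub>presented_group A R\<^esub>"
    using assms by (simp add: mult_word_class one_presented_group)
qed (use assms in \<open>auto simp: carrier_presented_group\<close>)

lemma word_val_presented_group:
  assumes "u \<in> words A"
  shows "word_val (presented_group A R) (\<lambda>a. word_class A R [Gen a]) u = word_class A R u"
  using assms
proof (induction u)
  case Nil
  show ?case by (simp add: one_presented_group)
next
  case (Cons x u)
  have "letter_val (presented_group A R) (\<lambda>a. word_class A R [Gen a]) x = word_class A R [x]"
    using Cons.prems by (auto simp: inv_word_class_Gen)
  then show ?case using Cons by (simp add: mult_word_class)
qed

lemma presented_group_generated:
  "generate (presented_group A R) ((\<lambda>a. word_class A R [Gen a]) ` A) = carrier (presented_group A R)"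
proof -
  have "(\<lambda>a. word_class A R [Gen a]) ` A \<subseteq> carrier (presented_group A R)"
    by (auto simp: carrier_presented_group)
  then show ?thesis
    by (simp add: group.generate_eq_word_vals[OF group_presented_group]
        word_val_presented_group carrier_presented_group)
qed

lemma word_class_relation:
  assumes "(u, v) \<in> R" "u \<in> words A" "v \<in> words A"
  shows "word_class A R u = word_class A R v"
  using assms by (simp add: word_class_eq_iff word_eq.rel)

lemma (in group_hom) hom_word_val:
  assumes "k ` A \<subseteq> carrier G" "u \<in> words A"
  shows "h (word_val G k u) = word_val H (\<lambda>a. h (k a)) u"
  using assms(2)
proof (induction u)
  case (Cons x u)
  have "h (letter_val G k x) = letter_val H (\<lambda>a. h (k a)) x"
    using Cons.prems assms(1) by (auto simp: image_subset_iff)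
  then show ?case
    using Cons G.word_val_closed[OF assms(1), of u] G.letter_val_closed[OF assms(1), of x] by simp
qed simp

text \<open>Von Dyck's theorem: evaluating any representative of a word class is well defined, because
  the derivation rules of \<^const>\<open>word_eq\<close> preserve the value.\<close>

lemma presented_group_universal:
  assumes "group G" and h: "h ` A \<subseteq> carrier G"
    and R: "\<And>u v. (u, v) \<in> R \<Longrightarrow> u \<in> words A \<Longrightarrow> v \<in> words A \<Longrightarrow> word_val G h u = word_val G h v"
  shows "\<exists>\<chi> \<in> hom (presented_group A R) G.
    \<forall>u \<in> words A. \<chi> (word_class A R u) = word_val G h u"
proof -
  interpret group G by fact
  let ?\<chi> = "\<lambda>U. word_val G h (SOME u. u \<in> U)"
  have val: "?\<chi> (word_class A R u) = word_val G h u" if "u \<in> words A" for u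
  proof -
    have "u \<in> word_class A R u"
      using that by (simp add: word_class_def word_eq.refl)
    then have "(SOME v. v \<in> word_class A R u) \<in> word_class A R u" by (rule someI)
    then have "word_eq A R u (SOME v. v \<in> word_class A R u)" by (simp add: word_class_def)
    then show ?thesis using word_val_respects_word_eq[OF h R] by metis
  qed
  have "?\<chi> \<in> hom (presented_group A R) G"
  proof (rule homI)
    show "?\<chi> U \<in> carrier G" if "U \<in> carrier (presented_group A R)" for U
    proof -
      obtain u where "u \<in> words A" "U = word_class A R u"
        using \<open>U \<in> _\<close> by (auto simp: carrier_presented_group)
      then show ?thesis using word_val_closed[OF h] by (simp only: val)
    qed
    show "?\<chi> (U \<otimes>\<^bsub>presented_group A R\<^esub> V) = ?\<chi> U \<otimes>\<^bsub>G\<^esub> ?\<chi> V"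
      if UV: "U \<in> carrier (presented_group A R)" "V \<in> carrier (presented_group A R)" for U V
    proof -
      obtain u v where "u \<in> words A" "U = word_class A R u" "v \<in> words A" "V = word_class A R v"
        using UV by (auto simp: carrier_presented_group)
      then show ?thesis by (simp only: val mult_word_class append_words word_val_append[OF h])
    qed
  qed
  then show ?thesis using val by (intro bexI[of _ ?\<chi>] ballI)
qed

section \<open>Changing the generators of a finitely presented group\<close>

fun inv_letter :: "'a letter \<Rightarrow> 'a letter" where
  "inv_letter (Gen a) = Inv a"
| "inv_letter (Inv a) = Gen a"

definition inv_word :: "'a letter list \<Rightarrow> 'a letter list" where
  "inv_word u = rev (map inv_letter u)"

fun subst_letter :: "('a \<Rightarrow> 'b letter list) \<Rightarrow> 'a letter \<Rightarrow> 'b letter list" where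
  "subst_letter \<sigma> (Gen a) = \<sigma> a"
| "subst_letter \<sigma> (Inv a) = inv_word (\<sigma> a)"

definition subst_word :: "('a \<Rightarrow> 'b letter list) \<Rightarrow> 'a letter list \<Rightarrow> 'b letter list" where
  "subst_word \<sigma> u = concat (map (subst_letter \<sigma>) u)"

lemma inv_word_words: "u \<in> words A \<Longrightarrow> inv_word u \<in> words A"
  by (induction u) (auto simp: inv_word_def)

lemma subst_word_words: "u \<in> words A \<Longrightarrow> \<sigma> ` A \<subseteq> words B \<Longrightarrow> subst_word \<sigma> u \<in> words B"
  by (induction u) (auto simp: subst_word_def intro!: inv_word_words)

lemma (in group) word_val_inv_word:
  assumes h: "h ` A \<subseteq> carrier G" and "u \<in> words A"
  shows "word_val G h (inv_word u) = inv (word_val G h u)"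
  using assms(2)
proof (induction u)
  case (Cons x u)
  have inv_x: "[inv_letter x] \<in> words A" and "word_val G h [inv_letter x] = inv (letter_val G h x)"
    using Cons.prems h by (auto simp: image_subset_iff)
  moreover have "inv_word (x # u) = inv_word u @ [inv_letter x]"
    by (simp add: inv_word_def)
  ultimately have "word_val G h (inv_word (x # u)) = word_val G h (inv_word u) \<otimes> inv (letter_val G h x)"
    using Cons.prems word_val_append[OF h inv_word_words inv_x, of u] by auto
  then show ?case
    using Cons word_val_closed[OF h, of u] letter_val_closed[OF h, of x]
    by (simp add: inv_mult_group)
qed (simp add: inv_word_def)

lemma (in group) word_val_subst_word:
  assumes h: "h ` B \<subseteq> carrier G" and \<sigma>: "\<sigma> ` A \<subseteq> words B" and "u \<in> words A"
  shows "word_val G h (subst_word \<sigma> u) = word_val G (\<lambda>a. word_val G h (\<sigma> a)) u"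
  using assms(3)
proof (induction u)
  case (Cons x u)
  have "word_val G h (subst_letter \<sigma> x) = letter_val G (\<lambda>a. word_val G h (\<sigma> a)) x"
    using Cons.prems \<sigma> by (auto intro!: word_val_inv_word[OF h])
  moreover have "subst_letter \<sigma> x \<in> words B"
    using Cons.prems \<sigma> by (auto intro!: inv_word_words)
  moreover have "subst_word \<sigma> (x # u) = subst_letter \<sigma> x @ subst_word \<sigma> u"
    by (simp add: subst_word_def)
  ultimately show ?case
    using Cons subst_word_words[OF _ \<sigma>, of u] by (simp add: word_val_append[OF h])
qed (simp add: subst_word_def)

text \<open>Finite presentability does not depend on the finite generating set.  Express every old
  generator \<open>a\<close> by a word \<open>\<sigma> a\<close> in the new ones and every new generator \<open>b\<close> by a word \<open>\<tau> b\<close> in the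
  old ones; the old relations rewritten by \<open>\<sigma>\<close>, together with the relations \<open>b = \<sigma> (\<tau> b)\<close>, present
  the group on the new generators, because under them the substitutions \<open>\<sigma>\<close> and \<open>\<tau>\<close> are mutually
  inverse.\<close>

theorem finite_presentation_on_generating_set:
  fixes A :: "'a set" and R
  defines "G \<equiv> presented_group A R"
  assumes "finite R" "finite B" and B: "B \<subseteq> carrier G" "generate G B = carrier G"
  shows "has_finite_presentation_on G B"
proof -
  interpret G: group G unfolding G_def by (rule group_presented_group)
  define gen where "gen = (\<lambda>a. word_class A R [Gen a])"
  have gen: "gen ` A \<subseteq> carrier G"
    by (auto simp: gen_def G_def carrier_presented_group)
  have B': "(\<lambda>b. b) ` B \<subseteq> carrier G" using B by simp
  have "\<exists>w. w \<in> words B \<and> word_val G (\<lambda>b. b) w = gen a" if "a \<in> A" for a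
  proof -
    have "gen a \<in> word_val G (\<lambda>b. b) ` words B"
      using gen that G.generate_eq_word_vals[OF B'] B(2) by auto
    then show ?thesis by force
  qed
  then obtain \<sigma> where \<sigma>: "\<And>a. a \<in> A \<Longrightarrow> \<sigma> a \<in> words B"
      "\<And>a. a \<in> A \<Longrightarrow> word_val G (\<lambda>b. b) (\<sigma> a) = gen a"
    by metis
  have "\<exists>u. u \<in> words A \<and> word_class A R u = b" if "b \<in> B" for b
    using that B(1) by (force simp: G_def carrier_presented_group)
  then obtain \<tau> where \<tau>: "\<And>b. b \<in> B \<Longrightarrow> \<tau> b \<in> words A" "\<And>b. b \<in> B \<Longrightarrow> word_class A R (\<tau> b) = b"
    by metis
  have \<sigma>': "\<sigma> ` A \<subseteq> words B" using \<sigma>(1) by auto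
  define R' where "R' = (\<lambda>(u, v). (subst_word \<sigma> u, subst_word \<sigma> v)) ` (R \<inter> words A \<times> words A)
      \<union> (\<lambda>b. ([Gen b], subst_word \<sigma> (\<tau> b))) ` B"
  have "finite R'" using \<open>finite R\<close> \<open>finite B\<close> by (simp add: R'_def)
  have R'_words: "R' \<subseteq> words B \<times> words B"
    using \<tau>(1) by (auto simp: R'_def intro: subst_word_words[OF _ \<sigma>'])
  define H where "H = presented_group B R'"
  interpret H: group H unfolding H_def by (rule group_presented_group)
  define new where "new = (\<lambda>b. word_class B R' [Gen b])"
  have new: "new ` B \<subseteq> carrier H"
    by (auto simp: new_def H_def carrier_presented_group)
  have val_new: "word_val H new w = word_class B R' w" if "w \<in> words B" for w
    unfolding H_def new_def by (rule word_val_presented_group[OF that])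
  have val_gen: "word_val G gen u = word_class A R u" if "u \<in> words A" for u
    unfolding G_def gen_def by (rule word_val_presented_group[OF that])
  have cong: "word_val K k u = word_val K k' u"
    if "u \<in> words C" "\<And>c. c \<in> C \<Longrightarrow> k c = k' c" for K :: "('k, 'l) monoid_scheme" and k k' u and C :: "'c set"
    using that by (induction u) auto
  have val_\<sigma>: "word_val G (\<lambda>b. b) (subst_word \<sigma> u) = word_class A R u" if "u \<in> words A" for u
  proof -
    have "word_val G (\<lambda>b. b) (subst_word \<sigma> u) = word_val G gen u"
      using cong[OF that \<sigma>(2)] by (simp only: G.word_val_subst_word[OF B' \<sigma>' that])
    then show ?thesis by (simp only: val_gen[OF that])
  qed

  \<comment> \<open>The homomorphism that sends every new generator to itself.\<close>
  have "word_val G (\<lambda>b. b) u = word_val G (\<lambda>b. b) v" if "(u, v) \<in> R'" for u v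
    using that unfolding R'_def
  proof
    assume "(u, v) \<in> (\<lambda>(u, v). (subst_word \<sigma> u, subst_word \<sigma> v)) ` (R \<inter> words A \<times> words A)"
    then obtain u' v' where "(u', v') \<in> R" "u' \<in> words A" "v' \<in> words A"
        "u = subst_word \<sigma> u'" "v = subst_word \<sigma> v'" by auto
    then show ?thesis using word_class_relation by (metis val_\<sigma>)
  next
    assume "(u, v) \<in> (\<lambda>b. ([Gen b], subst_word \<sigma> (\<tau> b))) ` B"
    then obtain b where "b \<in> B" "u = [Gen b]" "v = subst_word \<sigma> (\<tau> b)" by auto
    then show ?thesis using B(1) val_\<sigma>[OF \<tau>(1)] \<tau>(2) by auto
  qed
  then obtain \<beta> where \<beta>: "\<beta> \<in> hom H G"
      "\<And>w. w \<in> words B \<Longrightarrow> \<beta> (word_class B R' w) = word_val G (\<lambda>b. b) w"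
    using presented_group_universal[OF G.is_group B', of R'] unfolding H_def by metis

  \<comment> \<open>Its inverse sends an old generator \<open>a\<close> to the class of \<open>\<sigma> a\<close>.\<close>
  define old where "old = (\<lambda>a. word_class B R' (\<sigma> a))"
  have old: "old ` A \<subseteq> carrier H"
    using \<sigma>(1) by (auto simp: old_def H_def carrier_presented_group)
  have val_old: "word_val H old u = word_class B R' (subst_word \<sigma> u)" if "u \<in> words A" for u
  proof -
    have "word_val H old u = word_val H new (subst_word \<sigma> u)"
      using cong[OF that, of old "\<lambda>a. word_val H new (\<sigma> a)"] \<sigma>(1) val_new
      by (simp add: H.word_val_subst_word[OF new \<sigma>' that] old_def)
    then show ?thesis using val_new[OF subst_word_words[OF that \<sigma>']] by simp
  qed
  have "word_val H old u = word_val H old v" if "(u, v) \<in> R" "u \<in> words A" "v \<in> words A" for u v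
  proof -
    have "(subst_word \<sigma> u, subst_word \<sigma> v) \<in> R'" using that by (force simp: R'_def)
    then show ?thesis
      using word_class_relation[of _ _ R' B] R'_words that by (auto simp: val_old)
  qed
  then obtain \<alpha> where \<alpha>: "\<alpha> \<in> hom G H"
      "\<And>u. u \<in> words A \<Longrightarrow> \<alpha> (word_class A R u) = word_class B R' (subst_word \<sigma> u)"
    using presented_group_universal[OF H.is_group old, of R] val_old unfolding G_def by metis
  interpret \<alpha>: group_hom G H \<alpha> using \<alpha>(1) by unfold_locales

  have \<beta>\<alpha>: "\<beta> (\<alpha> x) = x" if x: "x \<in> carrier G" for x
  proof -
    obtain u where "u \<in> words A" "x = word_class A R u"
      using x by (auto simp: G_def carrier_presented_group)
    then show ?thesis using subst_word_words[OF _ \<sigma>'] by (simp add: \<alpha>(2) \<beta>(2) val_\<sigma>)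
  qed
  have \<alpha>_new: "\<alpha> b = new b" if "b \<in> B" for b
  proof -
    have "\<alpha> b = word_class B R' (subst_word \<sigma> (\<tau> b))"
      using \<alpha>(2)[OF \<tau>(1)] \<tau>(2) that by simp
    also have "\<dots> = new b"
      unfolding new_def
    proof (rule word_class_relation[symmetric])
      show "([Gen b], subst_word \<sigma> (\<tau> b)) \<in> R'" using that by (auto simp: R'_def)
    qed (use that \<tau>(1) subst_word_words[OF _ \<sigma>'] in auto)
    finally show ?thesis .
  qed
  have \<alpha>\<beta>: "\<alpha> (\<beta> y) = y" if y: "y \<in> carrier H" for y
  proof -
    obtain w where w: "w \<in> words B" "y = word_class B R' w"
      using y by (auto simp: H_def carrier_presented_group)
    have "\<alpha> (\<beta> y) = word_val H (\<lambda>b. \<alpha> b) w"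
      using w \<alpha>.hom_word_val[OF B' w(1)] by (simp add: \<beta>(2))
    also have "\<dots> = word_val H new w" by (rule cong[OF w(1)]) (rule \<alpha>_new)
    finally show ?thesis using w val_new by simp
  qed
  have "bij_betw \<beta> (carrier H) (carrier G)"
    by (rule bij_betw_byWitness[where f' = \<alpha>])
      (use \<alpha>\<beta> \<beta>\<alpha> \<alpha>.hom_closed hom_carrier[OF \<beta>(1)] in auto)
  then have "\<beta> \<in> iso H G" using \<beta>(1) by (simp add: iso_def)
  moreover have "\<beta> (word_class B R' [Gen b]) = b" if "b \<in> B" for b
    using \<beta>(2)[of "[Gen b]"] that B(1) by auto
  ultimately have "has_presentation G B R'"
    using B(1) R'_words G.is_group by (auto simp: has_presentation_def H_def)
  then show ?thesis
    using \<open>finite R'\<close> \<open>finite B\<close> by (auto simp: has_finite_presentation_on_def)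
qed

section \<open>Groups generated by classes of conjugate involutions\<close>

text \<open>A group with generators \<open>g a\<close> of order dividing two, where \<open>cl\<close> numbers classes of generators
  that are conjugate in the group.  The characters \<open>\<chi> i\<close>, dual to the classes, certify that different
  classes stay independent in the abelianisation.\<close>

locale involution_classes = group G for G (structure) +
  fixes A :: "'c set" and g :: "'c \<Rightarrow> 'a" and cl :: "'c \<Rightarrow> nat" and m :: nat
    and \<chi> :: "nat \<Rightarrow> 'a \<Rightarrow> int"
  assumes gen_closed: "g ` A \<subseteq> carrier G"
    and generated: "generate G (g ` A) = carrier G"
    and involution: "a \<in> A \<Longrightarrow> g a \<otimes> g a = \<one>"
    and classes: "cl ` A = {..<m}"
    and conjugate: "a \<in> A \<Longrightarrow> b \<in> A \<Longrightarrow> cl a = cl b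
      \<Longrightarrow> \<exists>x\<in>carrier G. g b = x \<otimes> g a \<otimes> inv x"
    and character: "i < m \<Longrightarrow> \<chi> i \<in> hom G (integer_mod_group 2)"
    and character_gen: "i < m \<Longrightarrow> a \<in> A \<Longrightarrow> \<chi> i (g a) = (if cl a = i then 1 else 0)"
begin

lemma character_mult:
  assumes "i < m" "x \<in> carrier G" "y \<in> carrier G"
  shows "\<chi> i (x \<otimes> y) = (\<chi> i x + \<chi> i y) mod 2"
  using hom_mult[OF character[OF assms(1)] assms(2,3)] by simp

lemma character_range: "i < m \<Longrightarrow> x \<in> carrier G \<Longrightarrow> \<chi> i x = 0 \<or> \<chi> i x = 1"
  using hom_in_carrier[OF character, of i x] by (auto simp: carrier_integer_mod_group)

lemma character_one: "i < m \<Longrightarrow> \<chi> i \<one> = 0"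
  using hom_one[OF character is_group, of i] by simp

definition rep :: "nat \<Rightarrow> 'c" where
  "rep i = (SOME a. a \<in> A \<and> cl a = i)"

lemma rep: "i < m \<Longrightarrow> rep i \<in> A \<and> cl (rep i) = i"
proof -
  assume "i < m"
  then have "\<exists>a. a \<in> A \<and> cl a = i" using classes by (metis imageE lessThan_iff)
  then show ?thesis unfolding rep_def by (rule someI_ex)
qed

definition \<epsilon> :: "'a \<Rightarrow> nat \<Rightarrow> int" where
  "\<epsilon> x = (\<lambda>i\<in>{..<m}. \<chi> i x)"

abbreviation Z2m :: "(nat \<Rightarrow> int) monoid" where
  "Z2m \<equiv> product_group {..<m} (\<lambda>_. integer_mod_group 2)"

lemma \<epsilon>_hom: "group_hom G Z2m \<epsilon>"
proof -
  have "\<epsilon> \<in> hom G Z2m"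
    using hom_in_carrier[OF character]
    by (intro homI) (auto simp: \<epsilon>_def character_mult)
  then show ?thesis
    by (intro group_hom.intro group_hom_axioms.intro is_group) auto
qed

lemma characters_independent:
  assumes "T \<subseteq> {..<m}"
  shows "\<exists>x\<in>carrier G. \<forall>i<m. \<chi> i x = (if i \<in> T then 1 else 0)"
proof -
  have "finite T" using assms finite_subset by blast
  then show ?thesis
    using assms
  proof (induction T)
    case empty
    show ?case using character_one by auto
  next
    case (insert k T)
    then obtain x where x: "x \<in> carrier G" "\<forall>i<m. \<chi> i x = (if i \<in> T then 1 else 0)" by auto
    have k: "rep k \<in> A" "cl (rep k) = k" using rep insert.prems by auto
    then have "g (rep k) \<in> carrier G" using gen_closed by auto
    then have "x \<otimes> g (rep k) \<in> carrier G"
      "\<forall>i<m. \<chi> i (x \<otimes> g (rep k)) = (if i \<in> insert k T then 1 else 0)"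
      using x k insert.hyps by (auto simp: character_mult character_gen)
    then show ?case by blast
  qed
qed

text \<open>A generating set \<open>B\<close> separates the homomorphisms to the group of order two, and the sums of
  characters over the \<open>2 ^ m\<close> sets of classes are distinct homomorphisms; each of them is given by
  the subset of \<open>B\<close> on which it is nonzero.\<close>

lemma card_generating_set_ge:
  assumes B: "B \<subseteq> carrier G" "generate G B = carrier G" and "finite B"
  shows "m \<le> card B"
proof -
  define p where "p = (\<lambda>T x. (\<Sum>i\<in>T. \<chi> i x) mod 2)"
  have p_mult: "p T (x \<otimes> y) = (p T x + p T y) mod 2"
    if T: "T \<subseteq> {..<m}" and xy: "x \<in> carrier G" "y \<in> carrier G" for T x y
  proof -
    have "p T (x \<otimes> y) = (\<Sum>i\<in>T. (\<chi> i x + \<chi> i y) mod 2) mod 2"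
      unfolding p_def using T xy by (intro arg_cong[where f = "\<lambda>n. n mod 2"] sum.cong)
        (auto simp: character_mult)
    also have "\<dots> = (\<Sum>i\<in>T. \<chi> i x + \<chi> i y) mod 2" by (rule mod_sum_eq)
    also have "\<dots> = (p T x + p T y) mod 2" by (simp add: p_def sum.distrib mod_add_eq)
    finally show ?thesis .
  qed
  have p_hom: "p T \<in> hom G (integer_mod_group 2)" if "T \<subseteq> {..<m}" for T
    using p_mult[OF that] by (intro homI) (auto simp: carrier_integer_mod_group p_def)
  have p_rep: "p T (g (rep i)) = (if i \<in> T then 1 else 0)" if "T \<subseteq> {..<m}" "i < m" for T i
  proof -
    have "(\<Sum>j\<in>T. \<chi> j (g (rep i))) = (\<Sum>j\<in>T. if j = i then 1 else 0)"
      using that rep by (intro sum.cong) (auto simp: character_gen)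
    also have "\<dots> = (if i \<in> T then 1 else 0)"
      using that finite_subset[of T "{..<m}"] by (subst sum.delta) auto
    finally show ?thesis by (simp add: p_def)
  qed
  let ?f = "\<lambda>T. {b \<in> B. p T b = 1}"
  have "inj_on ?f (Pow {..<m})"
  proof (rule inj_onI)
    fix T U assume "T \<in> Pow {..<m}" "U \<in> Pow {..<m}" and eq: "?f T = ?f U"
    then have TU: "T \<subseteq> {..<m}" "U \<subseteq> {..<m}" by auto
    have p_inv: "p V (inv x) = p V x" if V: "V \<subseteq> {..<m}" and x: "x \<in> carrier G" for V x
    proof -
      have "p V (x \<otimes> inv x) = (p V x + p V (inv x)) mod 2" using V x by (intro p_mult) auto
      moreover have "p V \<one> = 0" using V by (auto simp: p_def character_one subset_iff)
      ultimately have "(p V x + p V (inv x)) mod 2 = 0" using x by simp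
      then show ?thesis unfolding p_def by presburger
    qed
    have "p T x = p U x" if "x \<in> generate G B" for x
      using that
    proof induction
      case one
      show ?case using TU by (simp add: p_def character_one subset_iff)
    next
      case (incl b)
      then have "p T b = 1 \<longleftrightarrow> p U b = 1" using eq by blast
      then show ?case unfolding p_def by presburger
    next
      case (inv b)
      then have "p T b = 1 \<longleftrightarrow> p U b = 1" using eq by blast
      then have "p T b = p U b" unfolding p_def by presburger
      then show ?case using inv B(1) TU p_inv by auto
    next
      case (eng x y)
      then show ?case using generate_in_carrier[OF B(1)] TU by (simp add: p_mult)
    qed
    then have "p T (g (rep i)) = p U (g (rep i))" if "i < m" for i
      using that rep gen_closed B(2) by auto
    then have "i \<in> T \<longleftrightarrow> i \<in> U" if "i < m" for i
      using that p_rep TU by (metis zero_neq_one)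
    then show "T = U" using TU by auto
  qed
  moreover have "?f ` Pow {..<m} \<subseteq> Pow B" by auto
  ultimately have "card (Pow {..<m}) \<le> card (Pow B)"
    using \<open>finite B\<close> by (intro card_inj_on_le) auto
  then have "(2::nat) ^ m \<le> 2 ^ card B" using \<open>finite B\<close> by (simp add: card_Pow)
  then show ?thesis by simp
qed

text \<open>The characters together form a surjection \<open>\<epsilon>\<close> onto an abelian group, so only
  \<open>kernel \<subseteq> derived\<close> is at stake.  Modulo the derived subgroup all generators of a class agree, hence
  the image \<open>\<pi> x\<close> of \<open>x\<close> is the product, over the classes with \<open>\<chi> i x = 1\<close>, of one representative each;
  this product \<open>\<psi> x\<close> depends on \<open>\<epsilon> x\<close> only.\<close>

lemma abelianisation_iso: "abelianisation G \<cong> Z2m"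
proof -
  interpret \<epsilon>: group_hom G Z2m \<epsilon> by (rule \<epsilon>_hom)
  define D where "D = derived G (carrier G)"
  interpret D: normal D G unfolding D_def using derived_self_is_normal .
  define Q where "Q = G Mod D"
  interpret Q: comm_group Q unfolding Q_def D_def by (rule derived_quot_is_comm_group)
  define \<pi> where "\<pi> x = D #> x" for x
  have \<pi>: "group_hom G Q \<pi>"
    unfolding \<pi>_def Q_def using D.r_coset_hom_Mod
    by (intro group_hom.intro group_hom_axioms.intro D.factorgroup_is_group is_group)
  interpret \<pi>: group_hom G Q \<pi> by (rule \<pi>)
  have g: "g a \<in> carrier G" if "a \<in> A" for a using that gen_closed by auto
  have \<pi>_cong: "\<pi> (g a) = \<pi> (g b)" if ab: "a \<in> A" "b \<in> A" "cl a = cl b" for a b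
  proof -
    obtain x where x: "x \<in> carrier G" "g b = x \<otimes> g a \<otimes> inv x"
      using conjugate[OF ab] by auto
    have closed: "\<pi> x \<in> carrier Q" "\<pi> (g a) \<in> carrier Q"
      using x(1) g[OF ab(1)] by simp_all
    have "\<pi> (g b) = \<pi> x \<otimes>\<^bsub>Q\<^esub> \<pi> (g a) \<otimes>\<^bsub>Q\<^esub> inv\<^bsub>Q\<^esub> \<pi> x"
      unfolding x(2) using x(1) g[OF ab(1)] by simp
    also have "\<dots> = \<pi> (g a)"
      using closed by (simp only: Q.m_comm[of "\<pi> x"] Q.inv_closed Q.m_assoc Q.r_inv Q.r_one)
    finally show ?thesis ..
  qed
  define q where "q i = \<pi> (g (rep i))" for i
  have q: "q i \<in> carrier Q" "q i \<otimes>\<^bsub>Q\<^esub> q i = \<one>\<^bsub>Q\<^esub>" if "i < m" for i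
  proof -
    show "q i \<in> carrier Q" using rep[OF that] g by (simp add: q_def)
    have "q i \<otimes>\<^bsub>Q\<^esub> q i = \<pi> (g (rep i) \<otimes> g (rep i))"
      using rep[OF that] g by (simp add: q_def)
    then show "q i \<otimes>\<^bsub>Q\<^esub> q i = \<one>\<^bsub>Q\<^esub>" using rep[OF that] involution by simp
  qed
  define \<psi> where "\<psi> x = finprod Q (\<lambda>i. if \<chi> i x = 1 then q i else \<one>\<^bsub>Q\<^esub>) {..<m}" for x
  have \<psi>_mult: "\<psi> (x \<otimes> y) = \<psi> x \<otimes>\<^bsub>Q\<^esub> \<psi> y" if xy: "x \<in> carrier G" "y \<in> carrier G" for x y
  proof -
    have "\<psi> (x \<otimes> y) = finprod Q (\<lambda>i. (if \<chi> i x = 1 then q i else \<one>\<^bsub>Q\<^esub>)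
        \<otimes>\<^bsub>Q\<^esub> (if \<chi> i y = 1 then q i else \<one>\<^bsub>Q\<^esub>)) {..<m}"
      unfolding \<psi>_def
    proof (rule Q.finprod_cong')
      fix i assume "i \<in> {..<m}"
      then show "(if \<chi> i (x \<otimes> y) = 1 then q i else \<one>\<^bsub>Q\<^esub>) = (if \<chi> i x = 1 then q i else \<one>\<^bsub>Q\<^esub>)
        \<otimes>\<^bsub>Q\<^esub> (if \<chi> i y = 1 then q i else \<one>\<^bsub>Q\<^esub>)"
        using q character_range[of i x] character_range[of i y] xy
        by (auto simp: character_mult)
    qed (use q in auto)
    then show ?thesis using q unfolding \<psi>_def by (subst (asm) Q.finprod_multf) auto
  qed
  have \<psi>_closed: "\<psi> x \<in> carrier Q" for x
    unfolding \<psi>_def using q by (intro Q.finprod_closed) auto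
  have \<psi>_gen: "\<psi> (g a) = \<pi> (g a)" if "a \<in> A" for a
  proof -
    have "cl a < m" using that classes by auto
    have "\<psi> (g a) = finprod Q (\<lambda>i. if cl a = i then q i else \<one>\<^bsub>Q\<^esub>) {..<m}"
      unfolding \<psi>_def using q that by (intro Q.finprod_cong') (auto simp: character_gen)
    also have "\<dots> = q (cl a)"
      using \<open>cl a < m\<close> q by (intro Q.finprod_singleton) auto
    also have "\<dots> = \<pi> (g a)"
      unfolding q_def using rep[OF \<open>cl a < m\<close>] that by (intro \<pi>_cong) auto
    finally show ?thesis .
  qed
  have \<psi>: "\<psi> x = \<pi> x" if "x \<in> generate G (g ` A)" for x
    using that
  proof induction
    case one
    have "\<psi> \<one> = finprod Q (\<lambda>i. \<one>\<^bsub>Q\<^esub>) {..<m}"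
      unfolding \<psi>_def by (intro Q.finprod_cong') (auto simp: character_one)
    then show ?case by simp
  next
    case (incl x)
    then show ?case using \<psi>_gen by auto
  next
    case (inv x)
    then obtain a where a: "a \<in> A" "x = g a" by auto
    then have "inv x = x" using involution g by (intro inv_equality) auto
    then show ?case using \<psi>_gen a by simp
  next
    case (eng x y)
    then have "x \<in> carrier G" "y \<in> carrier G" using generated by auto
    then show ?case using eng by (simp add: \<psi>_mult)
  qed
  have ker: "kernel G Z2m \<epsilon> = D"
  proof
    show "kernel G Z2m \<epsilon> \<subseteq> D"
    proof
      fix x assume "x \<in> kernel G Z2m \<epsilon>"
      then have x: "x \<in> carrier G" "\<epsilon> x = (\<lambda>i\<in>{..<m}. 0)" by (auto simp: kernel_def)
      have "\<chi> i x = 0" if "i < m" for i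
        using fun_cong[OF x(2), of i] that by (simp add: \<epsilon>_def)
      then have "\<psi> x = finprod Q (\<lambda>i. \<one>\<^bsub>Q\<^esub>) {..<m}"
        unfolding \<psi>_def by (intro Q.finprod_cong') auto
      then have "\<pi> x = \<one>\<^bsub>Q\<^esub>" using \<psi> x(1) generated by simp
      then have "D #> x = D" by (simp add: \<pi>_def Q_def)
      then show "x \<in> D" using rcos_self[OF x(1) D.subgroup_axioms] by simp
    qed
    have "comm_group Z2m"
      by (rule group.group_comm_groupI[OF \<epsilon>.H.is_group]) (auto simp: add.commute)
    moreover have "derived Z2m (\<epsilon> ` carrier G) \<subseteq> {\<one>\<^bsub>Z2m\<^esub>}"
      by (simp only: comm_group.derived_eq_singleton[OF \<open>comm_group Z2m\<close> hom_carrier[OF \<epsilon>.homh]])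
    ultimately have "\<epsilon> ` D \<subseteq> {\<one>\<^bsub>Z2m\<^esub>}"
      using \<epsilon>.derived_img[of "carrier G"] unfolding D_def by auto
    then show "D \<subseteq> kernel G Z2m \<epsilon>" using D.subset by (auto simp: kernel_def)
  qed
  have "\<epsilon> ` carrier G = carrier Z2m"
  proof
    show "\<epsilon> ` carrier G \<subseteq> carrier Z2m" using \<epsilon>.hom_closed by blast
    show "carrier Z2m \<subseteq> \<epsilon> ` carrier G"
    proof
      fix f assume f: "f \<in> carrier Z2m"
      obtain x where x: "x \<in> carrier G" "\<forall>i<m. \<chi> i x = (if i \<in> {i \<in> {..<m}. f i = 1} then 1 else 0)"
        using characters_independent[of "{i \<in> {..<m}. f i = 1}"] by auto
      have "\<epsilon> x = f"
      proof
        fix i show "\<epsilon> x i = f i"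
        proof (cases "i < m")
          case True
          then have "f i \<in> {0..<2}" using f by (auto simp: carrier_integer_mod_group PiE_iff)
          then show ?thesis using True x(2) by (auto simp: \<epsilon>_def)
        next
          case False
          then show ?thesis using f by (auto simp: \<epsilon>_def PiE_iff extensional_def)
        qed
      qed
      then show "f \<in> \<epsilon> ` carrier G" using x(1) by blast
    qed
  qed
  from \<epsilon>.FactGroup_iso[OF this] show ?thesis
    unfolding ker by (simp add: abelianisation_def D_def)
qed

end

section \<open>Coxeter groups: length, reflections and the exchange condition\<close>

fun alternating :: "'a \<Rightarrow> 'a \<Rightarrow> nat \<Rightarrow> 'a list" where
  "alternating s t 0 = []"
| "alternating s t (Suc k) = s # alternating t s k"

lemma alternating_word_eq: "alternating_word s t k = map Gen (alternating s t k)"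
  by (induction s t k rule: alternating.induct) auto

lemma length_alternating [simp]: "length (alternating s t k) = k"
  by (induction s t k rule: alternating.induct) auto

lemma set_alternating: "s \<in> X \<Longrightarrow> t \<in> X \<Longrightarrow> set (alternating s t k) \<subseteq> X"
  by (induction s t k rule: alternating.induct) auto

lemma alternating_add:
  "alternating s t (m + n)
    = alternating s t m @ (if even m then alternating s t n else alternating t s n)"
  by (induction s t m rule: alternating.induct) auto

lemma rev_alternating:
  "rev (alternating s t k) = (if even k then alternating t s k else alternating s t k)"
proof (induction s t k rule: alternating.induct)
  case (2 s t k)
  have "rev (alternating t s k) @ [s] = (if even k then alternating s t k else alternating t s k) @ [s]"
    using 2 by simp
  also have "\<dots> = (if even (Suc k) then alternating t s (Suc k) else alternating s t (Suc k))"
    using alternating_add[of s t k 1] alternating_add[of t s k 1] by simp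
  finally show ?case by simp
qed simp

text \<open>The reflections of an alternating word are alternating words of odd length; this is the reason
  on the level of words.\<close>

lemma alternating_palindrome:
  "alternating s t k @ (if even k then s else t) # rev (alternating s t k) = alternating s t (2 * k + 1)"
proof -
  have "alternating s t (2 * k + 1) = alternating s t (Suc k + k)" by (simp add: mult_2)
  also have "\<dots> = alternating s t (Suc k) @ (if even (Suc k) then alternating s t k else alternating t s k)"
    by (rule alternating_add)
  also have "\<dots> = alternating s t (k + 1) @ rev (alternating s t k)"
    by (simp add: rev_alternating)
  also have "\<dots> = alternating s t k @ (if even k then s else t) # rev (alternating s t k)"
    using alternating_add[of s t k 1] by simp
  finally show ?thesis ..
qed

fun letter_gen :: "'a letter \<Rightarrow> 'a" where
  "letter_gen (Gen a) = a"
| "letter_gen (Inv a) = a"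

lemma map_letter_gen_words: "u \<in> words A \<Longrightarrow> set (map letter_gen u) \<subseteq> A"
  by (induction u) auto

lemma map_Gen_words: "map Gen xs \<in> words A \<longleftrightarrow> set xs \<subseteq> A"
  by (induction xs) auto

lemma (in group) inv_mult_cancel:
  assumes "x \<in> carrier G" "y \<in> carrier G"
  shows "inv x \<otimes> (x \<otimes> y) = y" "x \<otimes> (inv x \<otimes> y) = y"
  using assms m_assoc[of "inv x" x y] m_assoc[of x "inv x" y] by auto

locale coxeter_group = group W for W (structure) +
  fixes S :: "'a set" and M :: "'a \<Rightarrow> 'a \<Rightarrow> enat"
  assumes system: "coxeter_system W S M"
begin

abbreviation relations :: "('a letter list \<times> 'a letter list) set" where
  "relations \<equiv> coxeter_relations S M"

lemma gens_closed: "S \<subseteq> carrier W"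
  using system by (simp add: coxeter_system_def has_presentation_def)

lemma gen_closed [simp]: "s \<in> S \<Longrightarrow> s \<in> carrier W"
  using gens_closed by auto

lemma finite_S: "finite S"
  using system by (simp add: coxeter_system_def)

lemma M_sym: "s \<in> S \<Longrightarrow> t \<in> S \<Longrightarrow> M s t = M t s"
  using system unfolding coxeter_system_def coxeter_matrix_def by blast

lemma M_ge_2: "s \<in> S \<Longrightarrow> t \<in> S \<Longrightarrow> s \<noteq> t \<Longrightarrow> 2 \<le> M s t"
  using system unfolding coxeter_system_def coxeter_matrix_def by blast

lemma presentation:
  obtains \<phi> where "\<phi> \<in> iso (presented_group S relations) W"
    "\<And>u. u \<in> words S \<Longrightarrow> \<phi> (word_class S relations u) = word_val W (\<lambda>s. s) u"
proof -
  obtain \<phi> where \<phi>: "\<phi> \<in> iso (presented_group S relations) W"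
      "\<forall>a\<in>S. \<phi> (word_class S relations [Gen a]) = a"
    using system by (auto simp: coxeter_system_def has_presentation_def)
  interpret \<phi>: group_hom "presented_group S relations" W \<phi>
    using \<phi>(1) group_presented_group is_group
    by (intro group_hom.intro group_hom_axioms.intro) (auto simp: iso_def)
  have "\<phi> (word_class S relations u) = word_val W (\<lambda>s. s) u" if "u \<in> words S" for u
  proof -
    have "\<phi> (word_class S relations u)
        = word_val W (\<lambda>a. \<phi> (word_class S relations [Gen a])) u"
      unfolding word_val_presented_group[OF that, symmetric]
      using that by (intro \<phi>.hom_word_val) (auto simp: carrier_presented_group)
    also have "\<dots> = word_val W (\<lambda>s. s) u" using that \<phi>(2) by (induction u) auto
    finally show ?thesis .
  qed
  then show thesis by (rule that[OF \<phi>(1)])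
qed

lemma word_val_eq_iff:
  assumes "u \<in> words S" "v \<in> words S"
  shows "word_val W (\<lambda>s. s) u = word_val W (\<lambda>s. s) v \<longleftrightarrow> word_eq S relations u v"
proof -
  obtain \<phi> where \<phi>: "\<phi> \<in> iso (presented_group S relations) W"
    "\<And>u. u \<in> words S \<Longrightarrow> \<phi> (word_class S relations u) = word_val W (\<lambda>s. s) u"
    by (rule presentation) blast
  then have "inj_on \<phi> (word_class S relations ` words S)"
    by (simp add: iso_def bij_betw_def carrier_presented_group)
  then show ?thesis
    using assms by (simp only: \<phi>(2)[symmetric] inj_on_eq_iff[OF _ imageI imageI]
        word_class_eq_iff[OF assms(2)])
qed

lemma carrier_eq_word_vals: "carrier W = word_val W (\<lambda>s. s) ` words S"
proof -
  obtain \<phi> where \<phi>: "\<phi> \<in> iso (presented_group S relations) W"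
    "\<And>u. u \<in> words S \<Longrightarrow> \<phi> (word_class S relations u) = word_val W (\<lambda>s. s) u"
    by (rule presentation) blast
  have "carrier W = \<phi> ` word_class S relations ` words S"
    using \<phi>(1) by (simp add: iso_def bij_betw_def carrier_presented_group)
  also have "\<dots> = word_val W (\<lambda>s. s) ` words S"
    unfolding image_image using \<phi>(2) by (rule image_cong[OF HOL.refl])
  finally show ?thesis .
qed

lemma gen_square: "s \<in> S \<Longrightarrow> s \<otimes> s = \<one>"
proof -
  assume s: "s \<in> S"
  have "([Gen s, Gen s], []) \<in> relations" using s by (auto simp: coxeter_relations_def)
  then have "word_eq S relations [Gen s, Gen s] []" using s by (intro word_eq.rel) auto
  then have "word_val W (\<lambda>s. s) [Gen s, Gen s] = word_val W (\<lambda>s. s) []"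
    using s by (subst word_val_eq_iff) auto
  then show ?thesis using s by simp
qed

lemma gen_cancel: "s \<in> S \<Longrightarrow> x \<in> carrier W \<Longrightarrow> s \<otimes> (s \<otimes> x) = x"
  by (simp add: m_assoc[symmetric] gen_square)

lemma inv_gen: "s \<in> S \<Longrightarrow> inv s = s"
  by (rule inv_equality) (auto simp: gen_square)

definition lprod :: "'a list \<Rightarrow> 'a" where
  "lprod xs = foldr (\<otimes>) xs \<one>"

lemma lprod_simps [simp]: "lprod [] = \<one>" "lprod (x # xs) = x \<otimes> lprod xs"
  by (simp_all add: lprod_def)

lemma lprod_closed [simp]: "set xs \<subseteq> S \<Longrightarrow> lprod xs \<in> carrier W"
  by (induction xs) auto

lemma lprod_append [simp]:
  "set xs \<subseteq> S \<Longrightarrow> set ys \<subseteq> S \<Longrightarrow> lprod (xs @ ys) = lprod xs \<otimes> lprod ys"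
  by (induction xs) (auto simp: m_assoc)

lemma lprod_rev: "set xs \<subseteq> S \<Longrightarrow> lprod (rev xs) = inv (lprod xs)"
  by (induction xs) (auto simp: inv_mult_group inv_gen)

lemma word_val_eq_lprod: "u \<in> words S \<Longrightarrow> word_val W (\<lambda>s. s) u = lprod (map letter_gen u)"
  by (induction u) (auto simp: inv_gen)

lemma lprod_in_generate: "X \<subseteq> S \<Longrightarrow> set xs \<subseteq> X \<Longrightarrow> lprod xs \<in> generate W X"
  by (induction xs) (auto intro: generate.intros)

lemma generate_eq_lprods:
  assumes "X \<subseteq> S"
  shows "generate W X = lprod ` {xs. set xs \<subseteq> X}"
proof
  have "generate W ((\<lambda>s. s) ` X) = word_val W (\<lambda>s. s) ` words X"
    using assms gens_closed by (intro generate_eq_word_vals) auto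
  moreover have "word_val W (\<lambda>s. s) u \<in> lprod ` {xs. set xs \<subseteq> X}" if "u \<in> words X" for u
  proof -
    have "u \<in> words S" using that assms by (auto simp: words_def subset_iff)
    then show ?thesis using map_letter_gen_words[OF that] by (auto simp: word_val_eq_lprod)
  qed
  ultimately show "generate W X \<subseteq> lprod ` {xs. set xs \<subseteq> X}" by auto
qed (use lprod_in_generate[OF assms] in auto)

lemma obtain_word:
  assumes "w \<in> carrier W"
  obtains xs where "set xs \<subseteq> S" "lprod xs = w"
proof -
  obtain u where "u \<in> words S" "w = word_val W (\<lambda>s. s) u"
    using assms carrier_eq_word_vals by auto
  then show thesis
    using that[of "map letter_gen u"] map_letter_gen_words[of u S] by (simp add: word_val_eq_lprod)
qed

lemma braid_relation:
  assumes "s \<in> S" "t \<in> S" "s \<noteq> t" "M s t = enat k"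
  shows "lprod (alternating s t k) = lprod (alternating t s k)"
proof -
  have w: "alternating_word s t k \<in> words S" "alternating_word t s k \<in> words S"
    using assms by (simp_all add: alternating_word_eq map_Gen_words set_alternating)
  have "(alternating_word t s k, alternating_word s t k) \<in> relations"
    using assms by (auto simp: coxeter_relations_def)
  then have "word_eq S relations (alternating_word t s k) (alternating_word s t k)"
    using w by (intro word_eq.rel)
  then have "word_val W (\<lambda>s. s) (alternating_word t s k) = word_val W (\<lambda>s. s) (alternating_word s t k)"
    using w by (simp add: word_val_eq_iff)
  then show ?thesis using w by (simp add: word_val_eq_lprod) (simp add: alternating_word_eq o_def)
qed

text \<open>A function of words factors through the Coxeter group as soon as it respects the defining
  relations and is compatible with inserting words.  Parity of length, inversions and the dual
  geometric representation are all obtained from this principle, without constructing target groups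
  for homomorphisms.\<close>

lemma invariant_of_product:
  fixes F :: "'a list \<Rightarrow> 'c"
  assumes embed: "\<And>p u v q. set p \<subseteq> S \<Longrightarrow> set u \<subseteq> S \<Longrightarrow> set v \<subseteq> S \<Longrightarrow> set q \<subseteq> S
      \<Longrightarrow> lprod u = lprod v \<Longrightarrow> F u = F v \<Longrightarrow> F (p @ u @ q) = F (p @ v @ q)"
    and square: "\<And>s. s \<in> S \<Longrightarrow> F [s, s] = F []"
    and braid: "\<And>s t k. s \<in> S \<Longrightarrow> t \<in> S \<Longrightarrow> s \<noteq> t \<Longrightarrow> M s t = enat k
      \<Longrightarrow> F (alternating s t k) = F (alternating t s k)"
    and words: "set xs \<subseteq> S" "set ys \<subseteq> S" "lprod xs = lprod ys"
  shows "F xs = F ys"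
proof -
  have gen_Gen: "map (letter_gen \<circ> Gen) zs = zs" for zs :: "'a list" by (simp add: o_def)
  have "F (map letter_gen u) = F (map letter_gen v)" if "word_eq S relations u v" for u v
    using that
  proof induction
    case (rel u v)
    then show ?case
      by (auto simp: coxeter_relations_def alternating_word_eq gen_Gen square braid[symmetric])
  next
    case (embed u v p q)
    have uv: "u \<in> words S" "v \<in> words S" using word_eq_words[OF embed(1)] by auto
    then have "lprod (map letter_gen u) = lprod (map letter_gen v)"
      using embed(1) by (simp add: word_val_eq_iff flip: word_val_eq_lprod)
    then show ?case
      using embed uv by (auto intro!: assms(1) map_letter_gen_words)
  qed (auto simp: square)
  moreover have "word_eq S relations (map Gen xs) (map Gen ys)"
    using words by (subst word_val_eq_iff[symmetric]) (auto simp: map_Gen_words word_val_eq_lprod gen_Gen)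
  ultimately have "F (map letter_gen (map Gen xs)) = F (map letter_gen (map Gen ys))" by blast
  then show ?thesis by (simp add: gen_Gen)
qed

lemma length_parity:
  "set xs \<subseteq> S \<Longrightarrow> set ys \<subseteq> S \<Longrightarrow> lprod xs = lprod ys \<Longrightarrow> even (length xs) = even (length ys)"
  by (rule invariant_of_product[of "\<lambda>xs. even (length xs)"]) auto

text \<open>For a word with product \<open>w\<close>, right multiplication of \<open>w\<close> by the reflection attached to a position
  deletes the letter at that position.\<close>

fun reflections :: "'a list \<Rightarrow> 'a list" where
  "reflections [] = []"
| "reflections (x # xs) = (inv (lprod xs) \<otimes> x \<otimes> lprod xs) # reflections xs"

lemma reflections_closed: "set xs \<subseteq> S \<Longrightarrow> set (reflections xs) \<subseteq> carrier W"
  by (induction xs) auto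

lemma reflections_append:
  "set xs \<subseteq> S \<Longrightarrow> set ys \<subseteq> S \<Longrightarrow> reflections (xs @ ys)
    = map (\<lambda>r. inv (lprod ys) \<otimes> r \<otimes> lprod ys) (reflections xs) @ reflections ys"
  by (induction xs) (auto simp: inv_mult_group m_assoc)

lemma delete_letter:
  assumes "set xs \<subseteq> S" "r \<in> set (reflections xs)"
  shows "\<exists>ys z zs. xs = ys @ z # zs \<and> lprod xs \<otimes> r = lprod (ys @ zs)"
  using assms
proof (induction xs)
  case (Cons x xs)
  then have cl: "x \<in> S" "set xs \<subseteq> S" by auto
  from Cons.prems consider "r = inv (lprod xs) \<otimes> x \<otimes> lprod xs" | "r \<in> set (reflections xs)" by auto
  then show ?case
  proof cases
    case 1
    then have "lprod (x # xs) \<otimes> r = lprod ([] @ xs)"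
      using cl by (simp add: m_assoc inv_mult_cancel gen_cancel)
    then show ?thesis by blast
  next
    case 2
    then obtain ys z zs where *: "xs = ys @ z # zs" "lprod xs \<otimes> r = lprod (ys @ zs)"
      using Cons.IH cl by blast
    have "r \<in> carrier W" using 2 reflections_closed cl by blast
    then have "lprod (x # xs) \<otimes> r = lprod ((x # ys) @ zs)"
      using * cl by (simp add: m_assoc)
    then show ?thesis using *(1) by (metis append_Cons)
  qed
qed simp

lemma count_list_conjugates:
  assumes "set rs \<subseteq> carrier W" "y \<in> carrier W" "r \<in> carrier W"
  shows "count_list (map (\<lambda>r. inv y \<otimes> r \<otimes> y) rs) r = count_list rs (y \<otimes> r \<otimes> inv y)"
  using assms(1)
proof (induction rs)
  case (Cons a rs)
  have "inv y \<otimes> a \<otimes> y = r \<longleftrightarrow> a = y \<otimes> r \<otimes> inv y"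
    using Cons.prems assms by (auto simp: m_assoc inv_mult_cancel)
  then show ?case using Cons by auto
qed simp

text \<open>For a word with product \<open>w\<close> these are the reflections \<open>r\<close> for which \<open>w r\<close> is shorter than \<open>w\<close>.  Taking
  multiplicities modulo two makes the set independent of the word, reduced or not.\<close>

definition inversions :: "'a list \<Rightarrow> 'a set" where
  "inversions xs = {r \<in> carrier W. odd (count_list (reflections xs) r)}"

lemma reflections_rev_alternating:
  assumes "s \<in> S" "t \<in> S"
  shows "reflections (rev (alternating s t k))
    = rev (map (\<lambda>j. lprod (alternating s t (2 * j + 1))) [0..<k])"
proof (induction k)
  case (Suc k)
  let ?c = "if even k then s else t" and ?a = "alternating s t k"
  have a: "set ?a \<subseteq> S" "set (rev ?a) \<subseteq> S" "?c \<in> S"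
    using assms set_alternating[of s S t k] by auto
  have rev: "rev (alternating s t (Suc k)) = ?c # rev ?a"
    using alternating_add[of s t k 1] by simp
  have "inv (lprod (rev ?a)) \<otimes> ?c \<otimes> lprod (rev ?a) = lprod (?a @ ?c # rev ?a)"
    using a by (simp add: lprod_rev m_assoc)
  also have "\<dots> = lprod (alternating s t (2 * k + 1))" by (simp only: alternating_palindrome)
  finally show ?case unfolding rev using Suc by simp
qed simp

text \<open>Alternating words of odd length are palindromes, hence involutions.  The words on the two sides
  concatenate to an alternating word of length \<open>2 * k\<close>, whose product is \<open>(s t) ^ k = 1\<close>.\<close>

lemma alternating_inverse:
  assumes st: "s \<in> S" "t \<in> S" and rel: "lprod (alternating s t k) = lprod (alternating t s k)"
    and "j < k"
  shows "lprod (alternating s t (2 * j + 1)) = lprod (alternating t s (2 * (k - Suc j) + 1))"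
proof -
  have l: "set (alternating s t n) \<subseteq> S" "set (alternating t s n) \<subseteq> S" for n
    using st by (simp_all only: set_alternating)
  have "lprod (alternating s t (k + k)) = lprod (alternating s t k) \<otimes> lprod (rev (alternating s t k))"
    using l rel by (simp add: alternating_add rev_alternating)
  then have "lprod (alternating s t (k + k)) = \<one>"
    using l by (simp add: lprod_rev)
  moreover have "alternating s t (k + k)
      = alternating s t (2 * j + 1) @ alternating t s (2 * (k - Suc j) + 1)"
  proof -
    have "k + k = (2 * j + 1) + (2 * (k - Suc j) + 1)" using \<open>j < k\<close> by simp
    then show ?thesis using alternating_add[of s t "2 * j + 1" "2 * (k - Suc j) + 1"] by simp
  qed
  ultimately have "lprod (alternating s t (2 * j + 1)) \<otimes> lprod (alternating t s (2 * (k - Suc j) + 1)) = \<one>"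
    using l by (simp only: lprod_append)
  then have "inv (lprod (alternating s t (2 * j + 1))) = lprod (alternating t s (2 * (k - Suc j) + 1))"
    using l by (metis inv_equality inv_inv lprod_closed inv_comm)
  moreover have "inv (lprod (alternating s t (2 * j + 1))) = lprod (alternating s t (2 * j + 1))"
    using l by (simp only: lprod_rev[symmetric] rev_alternating) simp
  ultimately show ?thesis by simp
qed

text \<open>The two sides of a braid relation have the same reflections, listed in opposite order.\<close>

lemma inversions_braid:
  assumes st: "s \<in> S" "t \<in> S" and rel: "lprod (alternating s t k) = lprod (alternating t s k)"
  shows "inversions (alternating s t k) = inversions (alternating t s k)"
proof -
  let ?f = "\<lambda>s t j. lprod (alternating s t (2 * j + 1))"
  have "map (?f s t) [0..<k] = rev (map (?f t s) [0..<k])"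
    using alternating_inverse[OF st rel] by (intro nth_equalityI) (auto simp: rev_nth)
  then have "reflections (rev (alternating s t k)) = rev (reflections (rev (alternating t s k)))"
    using st by (simp add: reflections_rev_alternating)
  then have "count_list (reflections (rev (alternating s t k))) r
      = count_list (reflections (rev (alternating t s k))) r" for r by simp
  then have "inversions (rev (alternating s t k)) = inversions (rev (alternating t s k))"
    by (simp add: inversions_def)
  then show ?thesis by (auto simp: rev_alternating split: if_splits)
qed

lemma inversions_eq:
  assumes "set xs \<subseteq> S" "set ys \<subseteq> S" "lprod xs = lprod ys"
  shows "inversions xs = inversions ys"
  using _ _ _ assms
proof (rule invariant_of_product)
  fix p u v q
  assume l: "set p \<subseteq> S" "set u \<subseteq> S" "set v \<subseteq> S" "set q \<subseteq> S"
    and eq: "lprod u = lprod v" "inversions u = inversions v"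
  have cl: "lprod q \<in> carrier W" "lprod v \<in> carrier W" using l by auto
  let ?c = "\<lambda>y rs. map (\<lambda>r. inv y \<otimes> r \<otimes> y) rs"
  have split: "reflections (p @ x @ q)
      = ?c (lprod (x @ q)) (reflections p) @ ?c (lprod q) (reflections x) @ reflections q"
    if "set x \<subseteq> S" for x
    using l that reflections_append[of p "x @ q"] reflections_append[of x q] by simp
  have same: "lprod (u @ q) = lprod (v @ q)" using l eq(1) by simp
  have "odd (count_list (reflections (p @ u @ q)) r) = odd (count_list (reflections (p @ v @ q)) r)"
    if r: "r \<in> carrier W" for r
  proof -
    have "lprod q \<otimes> r \<otimes> inv lprod q \<in> carrier W" using cl r by simp
    then have "even (count_list (reflections u) (lprod q \<otimes> r \<otimes> inv lprod q))
        = even (count_list (reflections v) (lprod q \<otimes> r \<otimes> inv lprod q))"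
      using eq(2) by (auto simp: inversions_def set_eq_iff)
    moreover have "count_list (?c (lprod q) (reflections x)) r
        = count_list (reflections x) (lprod q \<otimes> r \<otimes> inv lprod q)" if "set x \<subseteq> S" for x
      by (rule count_list_conjugates[OF reflections_closed[OF that] cl(1) r])
    ultimately show ?thesis
      using l(2,3) by (simp only: split same count_list_append even_add)
  qed
  then show "inversions (p @ u @ q) = inversions (p @ v @ q)"
    by (auto simp: inversions_def)
next
  fix s assume "s \<in> S"
  then show "inversions [s, s] = inversions []"
    by (auto simp: inversions_def inv_gen gen_square m_assoc)
next
  fix s t k assume "s \<in> S" "t \<in> S" "s \<noteq> t" "M s t = enat k"
  then show "inversions (alternating s t k) = inversions (alternating t s k)"
    using braid_relation by (intro inversions_braid)
qed

definition len :: "'a \<Rightarrow> nat" where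
  "len w = (LEAST n. \<exists>xs. set xs \<subseteq> S \<and> lprod xs = w \<and> length xs = n)"

lemma len_le: "set xs \<subseteq> S \<Longrightarrow> len (lprod xs) \<le> length xs"
  unfolding len_def by (rule Least_le) auto

lemma obtain_reduced_word:
  assumes "w \<in> carrier W"
  obtains xs where "set xs \<subseteq> S" "lprod xs = w" "length xs = len w"
proof -
  obtain ys where "set ys \<subseteq> S" "lprod ys = w" using assms by (rule obtain_word)
  then have "\<exists>xs. set xs \<subseteq> S \<and> lprod xs = w \<and> length xs = length ys" by blast
  then have "\<exists>xs. set xs \<subseteq> S \<and> lprod xs = w \<and> length xs = len w"
    unfolding len_def by (rule LeastI)
  then obtain xs where "set xs \<subseteq> S" "lprod xs = w" "length xs = len w" by blast
  then show thesis by (rule that)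
qed

lemma len_one [simp]: "len \<one> = 0"
  using len_le[of "[]"] by simp

lemma len_eq_0: "w \<in> carrier W \<Longrightarrow> len w = 0 \<Longrightarrow> w = \<one>"
  by (erule obtain_reduced_word) simp

lemma len_inv_le: "w \<in> carrier W \<Longrightarrow> len (inv w) \<le> len w"
proof -
  assume "w \<in> carrier W"
  then obtain xs where xs: "set xs \<subseteq> S" "lprod xs = w" "length xs = len w"
    by (rule obtain_reduced_word)
  then have "inv w = lprod (rev xs)" by (simp add: lprod_rev)
  then show ?thesis using len_le[of "rev xs"] xs by auto
qed

lemma len_inv [simp]: "w \<in> carrier W \<Longrightarrow> len (inv w) = len w"
  using len_inv_le[of w] len_inv_le[of "inv w"] by simp

lemma len_mult_le: "v \<in> carrier W \<Longrightarrow> w \<in> carrier W \<Longrightarrow> len (v \<otimes> w) \<le> len v + len w"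
proof -
  assume vw: "v \<in> carrier W" "w \<in> carrier W"
  obtain xs where xs: "set xs \<subseteq> S" "lprod xs = v" "length xs = len v"
    using vw(1) by (rule obtain_reduced_word)
  obtain ys where ys: "set ys \<subseteq> S" "lprod ys = w" "length ys = len w"
    using vw(2) by (rule obtain_reduced_word)
  show ?thesis using len_le[of "xs @ ys"] xs ys by simp
qed

lemma even_len: "set xs \<subseteq> S \<Longrightarrow> even (len (lprod xs)) = even (length xs)"
proof -
  assume xs: "set xs \<subseteq> S"
  then have "lprod xs \<in> carrier W" by simp
  then obtain ys where "set ys \<subseteq> S" "lprod ys = lprod xs" "length ys = len (lprod xs)"
    by (rule obtain_reduced_word)
  then show ?thesis using length_parity[of ys xs] xs by simp
qed

lemma len_gen: "s \<in> S \<Longrightarrow> len s = 1"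
proof -
  assume "s \<in> S"
  then have "len s \<le> 1" "odd (len s)" using len_le[of "[s]"] even_len[of "[s]"] by simp_all
  then show ?thesis by (metis even_zero le_neq_implies_less less_one)
qed

lemma len_mult_gen:
  assumes "w \<in> carrier W" "s \<in> S"
  shows "len (w \<otimes> s) = len w + 1 \<or> len w = len (w \<otimes> s) + 1"
proof -
  obtain xs where xs: "set xs \<subseteq> S" "lprod xs = w" using assms(1) by (rule obtain_word)
  have "even (len (w \<otimes> s)) \<noteq> even (len w)"
    using even_len[of "xs @ [s]"] even_len[of xs] xs assms by simp
  then have "len (w \<otimes> s) \<noteq> len w" by auto
  moreover have "len (w \<otimes> s) \<le> len w + 1" using len_mult_le[of w s] len_gen assms by simp
  moreover have "len w \<le> len (w \<otimes> s) + 1"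
    using len_mult_le[of "w \<otimes> s" s] len_gen assms by (simp add: m_assoc gen_square)
  ultimately show ?thesis by linarith
qed

lemma len_gen_mult:
  assumes "w \<in> carrier W" "s \<in> S"
  shows "len (s \<otimes> w) = len w + 1 \<or> len w = len (s \<otimes> w) + 1"
proof -
  have "inv (inv w \<otimes> s) = s \<otimes> w" using assms by (simp add: inv_mult_group inv_gen)
  then have "len (s \<otimes> w) = len (inv w \<otimes> s)" using assms len_inv[of "inv w \<otimes> s"] by simp
  then show ?thesis using len_mult_gen[of "inv w" s] assms by simp
qed

text \<open>Deleting a letter from a word of \<open>w\<close> yields \<open>w s\<close> if \<open>s\<close> occurs among the reflections of the word,
  so it suffices that \<open>s\<close> is an inversion of \<open>w\<close>.  It is not an inversion of the shorter element \<open>w s\<close>: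
  otherwise deleting a letter from a reduced word of \<open>w s\<close> would give a word of \<open>w\<close> that is too short.
  Multiplying by \<open>s\<close> on the right toggles the multiplicity of \<open>s\<close>.\<close>

theorem exchange:
  assumes xs: "set xs \<subseteq> S" and s: "s \<in> S" and less: "len (lprod xs \<otimes> s) < len (lprod xs)"
  obtains ys z zs where "xs = ys @ z # zs" "lprod xs \<otimes> s = lprod (ys @ zs)"
proof -
  have "lprod xs \<otimes> s \<in> carrier W" using xs s by simp
  then obtain us where us: "set us \<subseteq> S" "lprod us = lprod xs \<otimes> s"
      "length us = len (lprod xs \<otimes> s)"
    by (rule obtain_reduced_word)
  have undo_s: "lprod us \<otimes> s = lprod xs"
    unfolding us(2) using lprod_closed[OF xs] s by (simp only: m_assoc gen_closed gen_square r_one)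
  have "s \<notin> set (reflections us)"
  proof
    assume "s \<in> set (reflections us)"
    then obtain ys z zs where del: "us = ys @ z # zs" "lprod us \<otimes> s = lprod (ys @ zs)"
      using delete_letter[OF us(1)] by blast
    then have "len (lprod xs) \<le> length (ys @ zs)"
      using len_le[of "ys @ zs"] us(1) undo_s by auto
    then show False using less us(3) del by simp
  qed
  then have "count_list (reflections us) s = 0" by (simp add: count_list_0_iff)
  moreover have "count_list (reflections (us @ [s])) s = count_list (reflections us) s + 1"
    using us(1) s count_list_conjugates[OF reflections_closed[OF us(1)], of s s]
    by (simp add: reflections_append inv_gen gen_square m_assoc)
  ultimately have "s \<in> inversions (us @ [s])" using s by (simp add: inversions_def)
  also have "inversions (us @ [s]) = inversions xs"
    using us(1) s xs undo_s by (intro inversions_eq) auto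
  finally have "count_list (reflections xs) s \<noteq> 0"
    unfolding inversions_def by (auto intro: odd_pos)
  then have "s \<in> set (reflections xs)" by (simp add: count_list_0_iff)
  from delete_letter[OF xs this] show thesis using that by auto
qed

end

context coxeter_group
begin

section \<open>The dual geometric representation\<close>

text \<open>Twice the bilinear form of the geometric representation.\<close>

definition cartan :: "'a \<Rightarrow> 'a \<Rightarrow> real" where
  "cartan s t = (if s = t then 2 else case M s t of enat k \<Rightarrow> - 2 * cos (pi / k) | \<infinity> \<Rightarrow> - 2)"

text \<open>The function \<open>f\<close> lists the values of a linear functional on the simple roots \<open>\<alpha>\<^sub>q\<close>; the letter \<open>s\<close>
  composes the functional with the reflection \<open>\<alpha>\<^sub>q \<mapsto> \<alpha>\<^sub>q - cartan s q \<alpha>\<^sub>s\<close>.  The first letter of a word acts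
  first.\<close>

fun dual_action :: "'a list \<Rightarrow> ('a \<Rightarrow> real) \<Rightarrow> 'a \<Rightarrow> real" where
  "dual_action [] f = f"
| "dual_action (s # xs) f = dual_action xs (\<lambda>q. f q - cartan s q * f s)"

lemma dual_action_append: "dual_action (xs @ ys) f = dual_action ys (dual_action xs f)"
  by (induction xs arbitrary: f) auto

lemma cartan_self [simp]: "cartan s s = 2"
  by (simp add: cartan_def)

text \<open>Each step of an alternating word negates the value at its own letter and adds \<open>2 cos \<theta>\<close> times the
  old value to the value at the other letter.  The value met next thus satisfies the
  recursion of the Chebyshev polynomials, which is solved by sines.\<close>

lemma dual_action_alternating:
  fixes f :: "'a \<Rightarrow> real"
  assumes "s \<noteq> t" and K: "cartan s t = - 2 * cos \<theta>" "cartan t s = - 2 * cos \<theta>" and "sin \<theta> \<noteq> 0"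
  shows "dual_action (alternating s t n) f (if even n then s else t)
      = (f s * sin ((real n + 1) * \<theta>) + f t * sin (real n * \<theta>)) / sin \<theta> \<and>
    dual_action (alternating s t n) f (if even n then t else s)
      = - (f s * sin (real n * \<theta>) + f t * sin ((real n - 1) * \<theta>)) / sin \<theta>"
  using assms
proof (induction n arbitrary: s t f)
  case 0
  then show ?case by simp
next
  case (Suc n s t f)
  let ?f = "\<lambda>q. f q - cartan s q * f s"
  have three_term: "sin (x + \<theta>) = 2 * cos \<theta> * sin x - sin (x - \<theta>)" for x
    by (simp add: sin_add sin_diff)
  have rec: "sin ((real n + 2) * \<theta>) = 2 * cos \<theta> * sin ((real n + 1) * \<theta>) - sin (real n * \<theta>)"
    using three_term[of "(real n + 1) * \<theta>"] by (simp add: algebra_simps)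
  have rec': "sin ((real n + 1) * \<theta>) = 2 * cos \<theta> * sin (real n * \<theta>) - sin ((real n - 1) * \<theta>)"
    using three_term[of "real n * \<theta>"] by (simp add: algebra_simps)
  note IH = Suc.IH[of t s ?f, OF Suc.prems(1)[symmetric] Suc.prems(3,2,4)]
  have "dual_action (alternating s t (Suc n)) f (if even (Suc n) then s else t)
      = dual_action (alternating t s n) ?f (if even n then t else s)" by simp
  also have "\<dots> = (?f t * sin ((real n + 1) * \<theta>) + ?f s * sin (real n * \<theta>)) / sin \<theta>"
    using IH by (rule conjunct1)
  also have "?f t * sin ((real n + 1) * \<theta>) + ?f s * sin (real n * \<theta>)
      = f s * sin ((real n + 2) * \<theta>) + f t * sin ((real n + 1) * \<theta>)"
    unfolding Suc.prems cartan_self rec by (simp add: algebra_simps)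
  finally have next_letter: "dual_action (alternating s t (Suc n)) f (if even (Suc n) then s else t)
      = (f s * sin ((real n + 2) * \<theta>) + f t * sin ((real n + 1) * \<theta>)) / sin \<theta>" .
  have "dual_action (alternating s t (Suc n)) f (if even (Suc n) then t else s)
      = dual_action (alternating t s n) ?f (if even n then s else t)" by simp
  also have "\<dots> = - (?f t * sin (real n * \<theta>) + ?f s * sin ((real n - 1) * \<theta>)) / sin \<theta>"
    using IH by (rule conjunct2)
  also have "?f t * sin (real n * \<theta>) + ?f s * sin ((real n - 1) * \<theta>)
      = f s * sin ((real n + 1) * \<theta>) + f t * sin (real n * \<theta>)"
    unfolding Suc.prems cartan_self rec' by (simp add: algebra_simps)
  finally have last_letter: "dual_action (alternating s t (Suc n)) f (if even (Suc n) then t else s)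
      = - (f s * sin ((real n + 1) * \<theta>) + f t * sin (real n * \<theta>)) / sin \<theta>" .
  have "real (Suc n) + 1 = real n + 2" "real (Suc n) - 1 = real n" "real (Suc n) = real n + 1"
    by simp_all
  with next_letter last_letter show ?case by (simp only:)
qed

lemma dual_action_span:
  assumes "set xs \<subseteq> {s, t}"
  shows "\<exists>a b. \<forall>q. dual_action xs f q = f q + a * cartan s q + b * cartan t q"
  using assms
proof (induction xs arbitrary: f)
  case Nil
  have "\<forall>q. dual_action [] f q = f q + 0 * cartan s q + 0 * cartan t q" by simp
  then show ?case by blast
next
  case (Cons x xs)
  then obtain a b where ab: "\<forall>q. dual_action xs (\<lambda>q. f q - cartan x q * f x) q
      = f q - cartan x q * f x + a * cartan s q + b * cartan t q"
    by fastforce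
  from Cons.prems consider "x = s" | "x = t" by auto
  then show ?case
  proof cases
    case 1
    with ab have "\<forall>q. dual_action (x # xs) f q = f q + (a - f s) * cartan s q + b * cartan t q"
      by (simp add: algebra_simps)
    then show ?thesis by blast
  next
    case 2
    with ab have "\<forall>q. dual_action (x # xs) f q = f q + a * cartan s q + (b - f t) * cartan t q"
      by (simp add: algebra_simps)
    then show ?thesis by blast
  qed
qed

text \<open>With \<open>\<theta> = \<pi> / k\<close> the formulas for the values at \<open>s\<close> and \<open>t\<close> after \<open>k\<close> steps agree for both words.  The
  action of either word changes \<open>f\<close> by a combination of the rows \<open>cartan s\<close> and \<open>cartan t\<close>, and a
  combination that vanishes at \<open>s\<close> and \<open>t\<close> is zero because the \<open>2 \<times> 2\<close> determinant \<open>4 sin\<^sup>2 \<theta>\<close> is not.\<close>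

lemma dual_action_braid:
  assumes st: "s \<in> S" "t \<in> S" "s \<noteq> t" "M s t = enat k"
  shows "dual_action (alternating s t k) = dual_action (alternating t s k)"
proof -
  define \<theta> where "\<theta> = pi / k"
  have k: "k \<ge> 2" using M_ge_2[OF st(1-3)] st(4) by (simp add: numeral_eq_enat)
  then have \<theta>: "real k * \<theta> = pi" "0 < \<theta>" "\<theta> < pi"
    by (simp_all add: \<theta>_def field_simps)
  then have pos: "sin \<theta> > 0" by (simp add: sin_gt_zero)
  have K: "cartan s t = - 2 * cos \<theta>" "cartan t s = - 2 * cos \<theta>"
    using st M_sym[of s t] by (simp_all add: cartan_def \<theta>_def)
  have "sin ((real k + 1) * \<theta>) = sin (pi + \<theta>)" "sin ((real k - 1) * \<theta>) = sin (pi - \<theta>)"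
    using \<theta>(1) by (simp_all add: algebra_simps)
  then have sines: "sin ((real k + 1) * \<theta>) = - sin \<theta>" "sin ((real k - 1) * \<theta>) = sin \<theta>"
    by simp_all
  have agree: "dual_action (alternating s t k) f q = dual_action (alternating t s k) f q"
    if q: "q = s \<or> q = t" for f q
  proof -
    have "sin \<theta> \<noteq> 0" using pos by simp
    from dual_action_alternating[OF st(3) K this, of k f]
      dual_action_alternating[OF st(3)[symmetric] K(2,1) this, of k f]
    show ?thesis using q unfolding sines \<theta>(1) by (cases "even k") auto
  qed
  have "dual_action (alternating s t k) f q = dual_action (alternating t s k) f q" for f q
  proof -
    obtain a b where ab: "\<forall>q. dual_action (alternating s t k) f q = f q + a * cartan s q + b * cartan t q"
      using dual_action_span[OF set_alternating[of s "{s, t}" t k]] by blast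
    obtain c d where cd: "\<forall>q. dual_action (alternating t s k) f q = f q + c * cartan s q + d * cartan t q"
      using dual_action_span[OF set_alternating[of t "{s, t}" s k]] by blast
    have "a - c = cos \<theta> * (b - d)" "b - d = cos \<theta> * (a - c)"
      using agree[of s f] agree[of t f] ab cd K by (simp_all add: algebra_simps)
    then have "(1 - cos \<theta> * cos \<theta>) * (a - c) = 0" by (simp add: algebra_simps)
    moreover have "1 - cos \<theta> * cos \<theta> = sin \<theta> * sin \<theta>"
      using sin_cos_squared_add[of \<theta>] by (simp add: power2_eq_square algebra_simps)
    ultimately have "a = c" using pos by simp
    with \<open>b - d = cos \<theta> * (a - c)\<close> have "b = d" by simp
    with \<open>a = c\<close> ab cd show ?thesis by simp
  qed
  then show ?thesis by blast
qed

lemma dual_action_eq: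
  "set xs \<subseteq> S \<Longrightarrow> set ys \<subseteq> S \<Longrightarrow> lprod xs = lprod ys \<Longrightarrow> dual_action xs = dual_action ys"
proof (rule invariant_of_product[of dual_action])
  show "dual_action (p @ u @ q) = dual_action (p @ v @ q)"
    if "dual_action u = dual_action v" for p u v q
    using that by (auto simp: dual_action_append)
  show "dual_action [s, s] = dual_action []" for s
    by (auto simp: fun_eq_iff)
qed (use dual_action_braid in auto)

text \<open>On the functional dual to \<open>\<alpha>\<^sub>s\<close>, the words \<open>s t\<close> and \<open>t s\<close> differ at \<open>\<alpha>\<^sub>t\<close> by twice the Cartan
  entry, which vanishes for \<open>k = 2\<close> only.\<close>

theorem M_eq_2_if_commute:
  assumes st: "s \<in> S" "t \<in> S" "s \<noteq> t" and comm: "s \<otimes> t = t \<otimes> s"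
  shows "M s t = 2"
proof -
  have "dual_action [s, t] = dual_action [t, s]"
    using st comm by (intro dual_action_eq) auto
  then have "dual_action [s, t] (\<lambda>q. if q = s then 1 else 0) t
      = dual_action [t, s] (\<lambda>q. if q = s then 1 else 0) t" by simp
  then have K: "cartan s t = 0" using st(3) by auto
  then obtain k where k: "M s t = enat k"
    using st(3) by (cases "M s t") (auto simp: cartan_def)
  then have "cos (pi / k) = 0" using K st(3) by (simp add: cartan_def)
  have "k \<ge> 2" using M_ge_2[OF st] k by (simp add: numeral_eq_enat)
  have "k \<le> 2"
  proof (rule ccontr)
    assume "\<not> k \<le> 2"
    then have "pi / k < pi / 2" by (intro divide_strict_left_mono) auto
    then have "cos (pi / k) > 0" using \<open>k \<ge> 2\<close> by (intro cos_gt_zero) auto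
    then show False using \<open>cos (pi / k) = 0\<close> by simp
  qed
  then show ?thesis using \<open>k \<ge> 2\<close> k by (simp add: numeral_eq_enat)
qed

section \<open>Parabolic subgroups and longest elements\<close>

lemma parabolic_closed: "X \<subseteq> S \<Longrightarrow> w \<in> generate W X \<Longrightarrow> w \<in> carrier W"
  using generate_in_carrier[of X w] gens_closed by auto

lemma parabolic_subgroup: "X \<subseteq> S \<Longrightarrow> subgroup (generate W X) W"
  using generate_is_subgroup[of X] gens_closed by auto

text \<open>Reading a word over \<open>X\<close> from left to right, a letter either lengthens the product or, by exchange,
  can be absorbed by deleting an earlier letter; no letter outside \<open>X\<close> ever appears.\<close>

lemma parabolic_reduced_word:
  assumes X: "X \<subseteq> S" and w: "w \<in> generate W X"
  shows "\<exists>xs. set xs \<subseteq> X \<and> lprod xs = w \<and> length xs = len w"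
proof -
  obtain us where us: "set us \<subseteq> X" "w = lprod us" using w generate_eq_lprods[OF X] by auto
  from us(1) have "\<exists>xs. set xs \<subseteq> X \<and> lprod xs = lprod us \<and> length xs = len (lprod us)"
  proof (induction us rule: rev_induct)
    case (snoc s us)
    then obtain xs where xs: "set xs \<subseteq> X" "lprod xs = lprod us" "length xs = len (lprod us)" by auto
    have s: "s \<in> X" "s \<in> S" and us: "set us \<subseteq> S" "set xs \<subseteq> S" using snoc.prems xs(1) X by auto
    have prod: "lprod (us @ [s]) = lprod xs \<otimes> s" using s us xs(2) by simp
    from us(1) s have "len (lprod us \<otimes> s) = len (lprod us) + 1 \<or> len (lprod us) = len (lprod us \<otimes> s) + 1"
      by (intro len_mult_gen) auto
    then show ?case
    proof
      assume "len (lprod us \<otimes> s) = len (lprod us) + 1"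
      then have "set (xs @ [s]) \<subseteq> X \<and> lprod (xs @ [s]) = lprod (us @ [s])
          \<and> length (xs @ [s]) = len (lprod (us @ [s]))"
        using xs s us by simp
      then show ?thesis by blast
    next
      assume less: "len (lprod us) = len (lprod us \<otimes> s) + 1"
      then have "len (lprod xs \<otimes> s) < len (lprod xs)" using xs(2) by simp
      from exchange[OF us(2) s(2) this] obtain ys z zs
        where ex: "xs = ys @ z # zs" "lprod xs \<otimes> s = lprod (ys @ zs)" .
      then have "set (ys @ zs) \<subseteq> X \<and> lprod (ys @ zs) = lprod (us @ [s])
          \<and> length (ys @ zs) = len (lprod (us @ [s]))"
        using xs less prod by auto
      then show ?thesis by blast
    qed
  qed simp
  then show ?thesis using us(2) by simp
qed

lemma generator_in_parabolic:
  assumes "X \<subseteq> S" "s \<in> S" "s \<in> generate W X"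
  shows "s \<in> X"
proof -
  obtain xs where xs: "set xs \<subseteq> X" "lprod xs = s" "length xs = 1"
    using parabolic_reduced_word[OF assms(1,3)] len_gen[OF assms(2)] by auto
  then obtain x where "xs = [x]" by (auto simp: length_Suc_conv)
  then show ?thesis using xs assms(1) by auto
qed

lemma len_eq_1:
  assumes "w \<in> carrier W" "len w = 1"
  shows "w \<in> S"
proof -
  obtain xs where xs: "set xs \<subseteq> S" "lprod xs = w" "length xs = len w"
    using assms(1) by (rule obtain_reduced_word)
  then obtain x where "xs = [x]" using assms(2) by (auto simp: length_Suc_conv)
  then show ?thesis using xs by auto
qed

definition descent :: "'a \<Rightarrow> 'a \<Rightarrow> bool" where
  "descent w s \<longleftrightarrow> len (w \<otimes> s) < len w"

lemma len_descent: "w \<in> carrier W \<Longrightarrow> s \<in> S \<Longrightarrow> descent w s \<Longrightarrow> len w = len (w \<otimes> s) + 1"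
  using len_mult_gen[of w s] by (auto simp: descent_def)

lemma len_ascent: "w \<in> carrier W \<Longrightarrow> s \<in> S \<Longrightarrow> \<not> descent w s \<Longrightarrow> len (w \<otimes> s) = len w + 1"
  using len_mult_gen[of w s] by (auto simp: descent_def)

text \<open>If every generator in \<open>X\<close> shortens \<open>w\<close>, then each \<open>x\<close> in \<open>W\<^sub>X\<close> is the end of a reduced word of \<open>w\<close>.
  Suppose that this is known for \<open>p\<close>, so that \<open>w = y p\<close> with lengths adding up, and that \<open>p s\<close> is longer than
  \<open>p\<close>.  Exchange deletes a letter from this word to give \<open>w s\<close>.  The letter does not lie in \<open>p\<close>, since
  otherwise \<open>p s\<close> would be shorter than \<open>p\<close>; so \<open>w s = y' p\<close> with \<open>y'\<close> shorter than \<open>y\<close>, and \<open>w = y' (p s)\<close>.\<close>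

theorem len_right_divisor:
  assumes X: "X \<subseteq> S" and w: "w \<in> carrier W" and desc: "\<And>s. s \<in> X \<Longrightarrow> descent w s"
    and x: "x \<in> generate W X"
  shows "len (w \<otimes> inv x) + len x = len w"
proof -
  have "len (w \<otimes> inv (lprod xs)) + length xs = len w"
    if "set xs \<subseteq> X" "length xs = len (lprod xs)" for xs
    using that
  proof (induction xs rule: rev_induct)
    case (snoc s xs)
    have s: "s \<in> X" "s \<in> S" and xs: "set xs \<subseteq> X" "set xs \<subseteq> S" using snoc.prems(1) X by auto
    define p where "p = lprod xs"
    have p: "p \<in> carrier W" using xs by (simp add: p_def)
    have prod: "lprod (xs @ [s]) = p \<otimes> s" using s xs by (simp add: p_def)
    have len_ps: "len (p \<otimes> s) = length xs + 1" using snoc.prems(2) prod by simp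
    have len_p: "len p = length xs"
      using len_le[OF xs(2)] len_ps len_mult_gen[OF p s(2)] by (auto simp: p_def)
    then have IH: "len (w \<otimes> inv p) + length xs = len w" using snoc.IH xs by (simp add: p_def)
    define y where "y = w \<otimes> inv p"
    have y: "y \<in> carrier W" using w p by (simp add: y_def)
    obtain ys where ys: "set ys \<subseteq> S" "lprod ys = y" "length ys = len y"
      using y by (rule obtain_reduced_word)
    have w_word: "lprod (ys @ xs) = w" using ys xs w p by (simp add: y_def p_def m_assoc)
    have "len (lprod (ys @ xs) \<otimes> s) < len (lprod (ys @ xs))"
      unfolding w_word using desc[OF s(1)] by (simp add: descent_def)
    moreover have "set (ys @ xs) \<subseteq> S" using ys xs by simp
    ultimately obtain us z vs
      where ex: "ys @ xs = us @ z # vs" "w \<otimes> s = lprod (us @ vs)"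
      using exchange[of "ys @ xs" s] s(2) unfolding w_word by blast
    have "\<exists>ys'. set ys' \<subseteq> S \<and> length ys = Suc (length ys') \<and> w \<otimes> s = lprod (ys' @ xs)"
    proof -
      from ex(1) consider (left) us' where "ys = us @ z # us'" "vs = us' @ xs"
        | (right) vs' where "us = ys @ vs'" "xs = vs' @ z # vs"
        by (auto simp: append_eq_append_conv2 append_eq_Cons_conv Cons_eq_append_conv)
      then show ?thesis
      proof cases
        case left
        then show ?thesis using ys(1) ex(2) by (intro exI[of _ "us @ us'"]) auto
      next
        case right
        \<comment> \<open>A deletion inside \<open>p\<close> would make \<open>p s\<close> shorter than \<open>p\<close>.\<close>
        have sub: "set vs' \<subseteq> S" "set vs \<subseteq> S" using right(2) xs(2) by auto
        have "y \<otimes> p = w" using w p by (simp add: y_def m_assoc)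
        then have "y \<otimes> (p \<otimes> s) = w \<otimes> s" using y p s(2) by (simp flip: m_assoc)
        also have "\<dots> = y \<otimes> lprod (vs' @ vs)" using ex(2) right(1) ys sub y by (simp add: m_assoc)
        finally have "y \<otimes> (p \<otimes> s) = y \<otimes> lprod (vs' @ vs)" .
        then have "p \<otimes> s = lprod (vs' @ vs)" using y p s(2) sub by simp
        then have "len (p \<otimes> s) \<le> length (vs' @ vs)" using len_le[of "vs' @ vs"] sub by simp
        then show ?thesis using len_ps right(2) by simp
      qed
    qed
    then obtain ys' where ys': "set ys' \<subseteq> S" "length ys = Suc (length ys')" "w \<otimes> s = lprod ys' \<otimes> p"
      using xs by (auto simp: p_def)
    have "w \<otimes> inv (p \<otimes> s) = lprod ys' \<otimes> p \<otimes> inv p"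
      unfolding ys'(3)[symmetric] using w s(2) p by (simp add: inv_mult_group inv_gen m_assoc)
    then have "w \<otimes> inv (p \<otimes> s) = lprod ys'" using ys'(1) p by (simp add: m_assoc)
    then have upper: "len (w \<otimes> inv (p \<otimes> s)) < len y" using len_le[OF ys'(1)] ys'(2) ys(3) by simp
    have "w = (w \<otimes> inv (p \<otimes> s)) \<otimes> (p \<otimes> s)" using w p s(2) by (simp add: m_assoc)
    then have "len w \<le> len (w \<otimes> inv (p \<otimes> s)) + len (p \<otimes> s)"
      using len_mult_le[of "w \<otimes> inv (p \<otimes> s)" "p \<otimes> s"] w p s(2) by simp
    then show ?case using upper IH len_ps prod by (simp add: y_def)
  qed (use w in simp)
  then show ?thesis using parabolic_reduced_word[OF X x] by metis
qed

text \<open>Put \<open>z = w s\<close>.  It is shortened by \<open>s\<close>, and also by \<open>t\<close>, because \<open>z t = s' (w t)\<close> is at most as long as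
  \<open>w\<close>.  Hence \<open>z\<close> has a reduced word that ends in \<open>s t s\<close>.  Cutting this end off leaves
  \<open>w t s = t' z\<close>, which is at most one letter shorter than \<open>z\<close>.  So \<open>s t s\<close> has length at most one, and
  then exchange turns it into \<open>t\<close>.\<close>

theorem conjugation_splits:
  assumes w: "w \<in> carrier W" and gens: "s \<in> S" "t \<in> S" "s' \<in> S" "t' \<in> S"
    and conj: "w \<otimes> s = s' \<otimes> w" "w \<otimes> t = t' \<otimes> w"
    and desc: "\<not> descent w s" "descent w t"
  shows "M s t = 2"
proof (rule M_eq_2_if_commute)
  show "s \<noteq> t" using desc by auto
  have up: "len (w \<otimes> s) = len w + 1" and down: "len w = len (w \<otimes> t) + 1"
    using len_ascent len_descent w gens desc by auto
  define z where "z = w \<otimes> s"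
  have z: "z \<in> carrier W" using w gens by (simp add: z_def)
  have "z \<otimes> t = s' \<otimes> (w \<otimes> t)"
    using w gens conj(1) by (simp add: z_def m_assoc)
  then have "len (z \<otimes> t) \<le> len w"
    using len_gen_mult[of "w \<otimes> t" s'] w gens down by auto
  then have "descent z t" using up by (simp add: descent_def z_def)
  moreover have "descent z s"
    using up w gens by (simp add: descent_def z_def m_assoc gen_square)
  ultimately have full: "descent z r" if "r \<in> {s, t}" for r using that by auto
  define x where "x = s \<otimes> t \<otimes> s"
  have x: "x \<in> generate W {s, t}" by (auto simp: x_def intro: generate.intros)
  have inv_x: "inv x = s \<otimes> (t \<otimes> s)" using gens by (simp add: x_def inv_mult_group inv_gen)
  have "z \<otimes> inv x = t' \<otimes> z"
  proof -
    have "z \<otimes> inv x = w \<otimes> (t \<otimes> s)"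
      unfolding inv_x z_def using w gens by (simp add: m_assoc gen_cancel)
    also have "\<dots> = t' \<otimes> (w \<otimes> s)" using w gens conj(2) by (simp flip: m_assoc)
    finally show ?thesis by (simp add: z_def)
  qed
  then have "len z \<le> len (z \<otimes> inv x) + 1" using len_gen_mult[of z t'] z gens by auto
  moreover have "len (z \<otimes> inv x) + len x = len z"
    using gens by (intro len_right_divisor[OF _ z full x]) auto
  ultimately have "len x \<le> 1" by simp
  have "s \<otimes> t \<noteq> \<one>"
    using \<open>s \<noteq> t\<close> gens inv_equality[of s t] inv_gen[of t] by auto
  then have "len (s \<otimes> t) \<noteq> 0" using len_eq_0[of "s \<otimes> t"] gens by auto
  moreover have "even (len (s \<otimes> t))" using even_len[of "[s, t]"] gens by simp
  ultimately have "1 < len (s \<otimes> t)" by (cases "len (s \<otimes> t) = 1") auto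
  then have "len (lprod [s, t] \<otimes> s) < len (lprod [s, t])"
    using \<open>len x \<le> 1\<close> gens by (simp add: x_def)
  from exchange[OF _ gens(1) this] gens obtain ys r zs
    where ex: "[s, t] = ys @ r # zs" "lprod [s, t] \<otimes> s = lprod (ys @ zs)" by auto
  from ex(1) have "ys @ zs = [t] \<or> ys @ zs = [s]"
    by (auto simp: Cons_eq_append_conv)
  then have "s \<otimes> t \<otimes> s = t \<or> s \<otimes> t \<otimes> s = s" using ex(2) gens by auto
  then show "s \<otimes> t = t \<otimes> s"
  proof
    assume "s \<otimes> t \<otimes> s = t"
    then have "s \<otimes> t \<otimes> s \<otimes> s = t \<otimes> s" by simp
    then show ?thesis using gens by (simp add: m_assoc gen_square)
  next
    assume "s \<otimes> t \<otimes> s = s"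
    then have "s \<otimes> t = \<one>" using gens by simp
    then show ?thesis using \<open>s \<otimes> t \<noteq> \<one>\<close> by simp
  qed
qed (use gens in auto)

lemma ex_longest_element:
  assumes X: "X \<subseteq> S" and "finite (generate W X)"
  shows "\<exists>w\<in>generate W X. \<forall>s\<in>X. descent w s"
proof -
  have "generate W X \<noteq> {}" using generate.one by blast
  then have "Max (len ` generate W X) \<in> len ` generate W X" using assms(2) by (intro Max_in) auto
  then obtain w where w: "w \<in> generate W X" "len w = Max (len ` generate W X)" by auto
  have "descent w s" if "s \<in> X" for s
  proof (rule ccontr)
    assume "\<not> descent w s"
    then have "len (w \<otimes> s) = len w + 1"
      using len_ascent[of w s] parabolic_closed[OF X w(1)] that X by auto
    moreover have "w \<otimes> s \<in> generate W X" using w(1) that by (auto intro: generate.intros)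
    then have "len (w \<otimes> s) \<le> Max (len ` generate W X)" using assms(2) by (intro Max_ge) auto
    ultimately show False using w(2) by simp
  qed
  then show ?thesis using w(1) by blast
qed

text \<open>The familiar formula for the longest element.  Comparing lengths, it yields that the longest element
  is an involution and that it permutes \<open>X\<close>.\<close>

lemma len_longest_minus:
  assumes X: "X \<subseteq> S" and w: "w \<in> generate W X" "\<And>s. s \<in> X \<Longrightarrow> descent w s"
    and x: "x \<in> generate W X"
  shows "len (w \<otimes> x) + len x = len w"
proof -
  have "inv x \<in> generate W X" using subgroup.m_inv_closed[OF parabolic_subgroup[OF X] x] .
  from len_right_divisor[OF X parabolic_closed[OF X w(1)] w(2) this]
  show ?thesis using parabolic_closed[OF X x] by simp
qed

lemma longest_element_unique:
  assumes X: "X \<subseteq> S" and w: "w \<in> generate W X" "\<And>s. s \<in> X \<Longrightarrow> descent w s"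
    and v: "v \<in> generate W X" "\<And>s. s \<in> X \<Longrightarrow> descent v s"
  shows "v = w"
proof -
  have cl: "v \<in> carrier W" "w \<in> carrier W" using parabolic_closed[OF X] v w by auto
  have "len (w \<otimes> inv v) + len v = len w" "len (v \<otimes> inv w) + len w = len v"
    using len_right_divisor[OF X cl(2) w(2) v(1)] len_right_divisor[OF X cl(1) v(2) w(1)] by auto
  then have "v \<otimes> inv w = \<one>" using len_eq_0[of "v \<otimes> inv w"] cl by auto
  then have "inv (inv w) = v" using cl by (intro inv_equality) auto
  then show ?thesis using cl by simp
qed

lemma longest_element_involution:
  assumes X: "X \<subseteq> S" and w: "w \<in> generate W X" "\<And>s. s \<in> X \<Longrightarrow> descent w s"
  shows "w \<otimes> w = \<one>"
  using len_longest_minus[OF X w w(1)] parabolic_closed[OF X w(1)] by (intro len_eq_0) auto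

lemma longest_element_conj:
  assumes X: "X \<subseteq> S" and w: "w \<in> generate W X" "\<And>s. s \<in> X \<Longrightarrow> descent w s" and s: "s \<in> X"
  shows "w \<otimes> s \<otimes> w \<in> X"
proof -
  have sS: "s \<in> S" using s X by auto
  have cl: "w \<in> carrier W" "s \<in> carrier W" using parabolic_closed[OF X w(1)] sS by auto
  have ww: "w \<otimes> w = \<one>" using longest_element_involution[OF X w] .
  then have inv_w: "inv w = w" using cl by (intro inv_equality) auto
  have mem: "s \<otimes> w \<in> generate W X" "w \<otimes> s \<otimes> w \<in> generate W X"
    using w(1) s by (auto intro: generate.intros)
  have "inv (w \<otimes> s) = s \<otimes> w" using cl sS inv_w by (simp add: inv_mult_group inv_gen)
  then have "len (s \<otimes> w) = len (w \<otimes> s)" using cl len_inv[of "w \<otimes> s"] by simp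
  moreover have "len w = len (w \<otimes> s) + 1" using len_descent[OF cl(1) sS w(2)[OF s]] .
  moreover have "len (w \<otimes> (s \<otimes> w)) + len (s \<otimes> w) = len w"
    by (rule len_longest_minus[OF X w mem(1)])
  ultimately have "len (w \<otimes> s \<otimes> w) = 1" using cl by (simp add: m_assoc)
  then have "w \<otimes> s \<otimes> w \<in> S" using cl by (intro len_eq_1) auto
  then show ?thesis using generator_in_parabolic[OF X _ mem(2)] by blast
qed

abbreviation FI :: "'a set set" where
  "FI \<equiv> finite_irreducible_subsets W S M"

lemma FI_D:
  assumes "X \<in> FI"
  shows "X \<noteq> {}" "X \<subseteq> S" "finite (generate W X)" "coxeter_irreducible M X"
  using assms by (simp_all add: finite_irreducible_subsets_def)

lemma irreducible_split:
  assumes "coxeter_irreducible M X" "\<And>s t. s \<in> X \<Longrightarrow> t \<in> X \<Longrightarrow> P s \<Longrightarrow> \<not> P t \<Longrightarrow> M s t = 2"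
  shows "(\<forall>s\<in>X. P s) \<or> (\<forall>s\<in>X. \<not> P s)"
proof (rule ccontr)
  assume "\<not> ?thesis"
  then have "{s \<in> X. P s} \<noteq> {} \<and> {s \<in> X. \<not> P s} \<noteq> {} \<and>
      {s \<in> X. P s} \<inter> {s \<in> X. \<not> P s} = {} \<and> {s \<in> X. P s} \<union> {s \<in> X. \<not> P s} = X \<and>
      (\<forall>s\<in>{s \<in> X. P s}. \<forall>t\<in>{s \<in> X. \<not> P s}. M s t = 2)"
    using assms(2) by auto
  then have "\<exists>X1 X2. X1 \<noteq> {} \<and> X2 \<noteq> {} \<and> X1 \<inter> X2 = {} \<and> X1 \<union> X2 = X \<and>
      (\<forall>s\<in>X1. \<forall>t\<in>X2. M s t = 2)"
    by (intro exI)
  with assms(1) show False unfolding coxeter_irreducible_def by (rule notE)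
qed

text \<open>Since \<open>w\<close> conjugates generators in \<open>X\<close> to generators, those that shorten \<open>w\<close> commute with those that
  do not.  Irreducibility makes one of the two sets empty, and \<open>w \<noteq> 1\<close> is shortened by its last letter.\<close>

lemma stabiliser_element:
  assumes X: "X \<subseteq> S" "coxeter_irreducible M X" and w: "w \<in> generate W X" "w \<noteq> \<one>"
    and conj: "(\<lambda>x. w \<otimes> x \<otimes> inv w) ` X = X"
  shows "\<forall>s\<in>X. descent w s"
proof -
  have cl: "w \<in> carrier W" using parabolic_closed[OF X(1) w(1)] .
  have image: "w \<otimes> s \<otimes> inv w \<in> S" "w \<otimes> s = (w \<otimes> s \<otimes> inv w) \<otimes> w" if "s \<in> X" for s
    using that conj X(1) cl by (auto simp: m_assoc)
  have "(\<forall>s\<in>X. \<not> descent w s) \<or> (\<forall>s\<in>X. \<not> \<not> descent w s)"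
  proof (rule irreducible_split[OF X(2)])
    fix s t assume st: "s \<in> X" "t \<in> X" "\<not> descent w s" "\<not> \<not> descent w t"
    then have "s \<in> S" "t \<in> S" using X(1) by auto
    from conjugation_splits[OF cl this image(1)[OF st(1)] image(1)[OF st(2)]
        image(2)[OF st(1)] image(2)[OF st(2)]] st(3,4)
    show "M s t = 2" by simp
  qed
  moreover have "\<exists>s\<in>X. descent w s"
  proof -
    obtain xs where xs: "set xs \<subseteq> X" "lprod xs = w" "length xs = len w"
      using parabolic_reduced_word[OF X(1) w(1)] by auto
    with w(2) have "xs \<noteq> []" by auto
    then obtain ys s where ys: "xs = ys @ [s]" by (metis rev_exhaust)
    then have s: "s \<in> X" "s \<in> S" "set ys \<subseteq> S" using xs(1) X(1) by auto
    have "w \<otimes> s = lprod ys"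
      unfolding xs(2)[symmetric] ys using s by (simp add: m_assoc gen_square)
    then have "len (w \<otimes> s) \<le> length ys" using len_le[of ys] s by simp
    then have "descent w s" using xs(3) ys by (simp add: descent_def)
    then show ?thesis using s(1) by blast
  qed
  ultimately show ?thesis by blast
qed

text \<open>Because \<open>W\<^sub>X\<close> is finite, an element that is shortened by all of \<open>X\<close> exists, and it permutes
  \<open>X\<close>.  Any other nontrivial element of \<open>W\<^sub>X\<close> that permutes \<open>X\<close> is shortened by all of \<open>X\<close> as well, hence
  equal to it; so the definite description in \<^const>\<open>omega\<close> denotes it.\<close>

theorem omega_longest:
  assumes "X \<in> FI"
  shows "omega W X \<in> generate W X" "\<And>s. s \<in> X \<Longrightarrow> descent (omega W X) s"
proof -
  have X: "X \<noteq> {}" "X \<subseteq> S" "finite (generate W X)" "coxeter_irreducible M X"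
    using FI_D[OF assms] by simp_all
  from ex_longest_element[OF X(2,3)] obtain w
    where w_all: "w \<in> generate W X" "\<forall>s\<in>X. descent w s" ..
  then have w: "w \<in> generate W X" "\<And>s. s \<in> X \<Longrightarrow> descent w s" by simp_all
  have cl: "w \<in> carrier W" using parabolic_closed[OF X(2) w(1)] .
  have "inv w = w" using longest_element_involution[OF X(2) w] cl by (intro inv_equality) auto
  have "w \<noteq> \<one>"
  proof
    assume "w = \<one>"
    obtain s where "s \<in> X" using X(1) by blast
    then show False using w(2)[of s] \<open>w = \<one>\<close> by (simp add: descent_def)
  qed
  let ?c = "\<lambda>x. w \<otimes> x \<otimes> inv w"
  have "inj_on ?c X"
    using cl X(2) gens_closed by (intro inj_onI) (simp add: subset_iff)
  moreover have "?c ` X \<subseteq> X"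
    using longest_element_conj[OF X(2) w] \<open>inv w = w\<close> by auto
  moreover have "finite X" using X(2) finite_S finite_subset by blast
  ultimately have "?c ` X = X" by (intro endo_inj_surj) auto
  have "omega W X = w"
    unfolding omega_def
  proof (rule the_equality)
    show "w \<in> generate W X \<and> w \<noteq> \<one> \<and> ?c ` X = X"
      using w(1) \<open>w \<noteq> \<one>\<close> \<open>?c ` X = X\<close> by simp
    fix v assume v: "v \<in> generate W X \<and> v \<noteq> \<one> \<and> (\<lambda>x. v \<otimes> x \<otimes> inv v) ` X = X"
    then have "\<forall>s\<in>X. descent v s" using stabiliser_element[OF X(2,4)] by blast
    then show "v = w" using longest_element_unique[OF X(2) w] v by blast
  qed
  then show "omega W X \<in> generate W X" "\<And>s. s \<in> X \<Longrightarrow> descent (omega W X) s"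
    using w by simp_all
qed

lemma omega_closed: "X \<in> FI \<Longrightarrow> omega W X \<in> carrier W"
  by (rule parabolic_closed[OF FI_D(2) omega_longest(1)])

lemma omega_square: "X \<in> FI \<Longrightarrow> omega W X \<otimes> omega W X = \<one>"
  by (rule longest_element_involution[OF FI_D(2) omega_longest])

lemma omega_conj_elem: "X \<in> FI \<Longrightarrow> s \<in> X \<Longrightarrow> omega W X \<otimes> s \<otimes> omega W X \<in> X"
  by (rule longest_element_conj[OF FI_D(2) omega_longest])

lemma omega_conj_twice:
  assumes "X \<in> FI" "s \<in> carrier W"
  shows "omega W X \<otimes> (omega W X \<otimes> s \<otimes> omega W X) \<otimes> omega W X = s"
proof -
  let ?w = "omega W X"
  have w: "?w \<in> carrier W" "?w \<otimes> ?w = \<one>" using omega_closed omega_square assms(1) by auto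
  have "?w \<otimes> (?w \<otimes> s \<otimes> ?w) \<otimes> ?w = (?w \<otimes> ?w) \<otimes> s \<otimes> (?w \<otimes> ?w)"
    using w(1) assms(2) by (simp only: m_assoc m_closed)
  then show ?thesis using w assms(2) by simp
qed

lemma omega_conj_involutive:
  assumes "X \<in> FI" "Y \<subseteq> S"
  shows "omega_conj W X (omega_conj W X Y) = Y"
proof -
  have "omega_conj W X (omega_conj W X Y) = (\<lambda>y. y) ` Y"
    unfolding omega_conj_def image_image
    using assms(2) by (intro image_cong omega_conj_twice[OF assms(1)]) auto
  then show ?thesis by simp
qed

lemma card_omega_conj:
  assumes "X \<in> FI" "Y \<subseteq> S"
  shows "card (omega_conj W X Y) = card Y"
proof -
  have "inj_on (\<lambda>y. omega W X \<otimes> y \<otimes> omega W X) Y"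
    using assms(2) gens_closed
    by (intro inj_on_inverseI[where g = "\<lambda>y. omega W X \<otimes> y \<otimes> omega W X"] omega_conj_twice[OF assms(1)])
      auto
  then show ?thesis unfolding omega_conj_def by (rule card_image)
qed

lemma omega_conj_self:
  assumes "X \<in> FI"
  shows "omega_conj W X X = X"
proof
  show *: "omega_conj W X X \<subseteq> X" using omega_conj_elem[OF assms] by (auto simp: omega_conj_def)
  have "omega_conj W X (omega_conj W X X) \<subseteq> omega_conj W X X"
    unfolding omega_conj_def[of W X "omega_conj W X X"] using image_mono[OF *]
    by (simp only: omega_conj_def[of W X X])
  then show "X \<subseteq> omega_conj W X X"
    by (simp only: omega_conj_involutive[OF assms FI_D(2)[OF assms]])
qed

text \<open>Let \<open>s \<in> Y - X\<close>.  Then \<open>\<omega>\<^sub>X s \<omega>\<^sub>X\<close> is a generator in the parabolic subgroup of \<open>X \<union> {s}\<close> but not in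
  \<open>X\<close>, so it is \<open>s\<close> itself.  Now \<open>\<omega>\<^sub>X\<close> is shortened by all of \<open>X\<close> but not by \<open>s\<close>, and the splitting of
  conjugated generators applies to \<open>s\<close> and each element of \<open>X\<close>.\<close>

theorem omega_conj_in_FI_cases:
  assumes X: "X \<in> FI" and Y: "Y \<in> FI" and sub: "omega_conj W X Y \<subseteq> S"
  shows "omega_conj W X Y = Y \<or> Y \<subset> X"
proof -
  define w where "w = omega W X"
  have XS: "X \<subseteq> S" "X \<noteq> {}" and YS: "Y \<subseteq> S" "coxeter_irreducible M Y"
    using FI_D[OF X] FI_D[OF Y] by simp_all
  have w: "w \<in> generate W X" "\<And>s. s \<in> X \<Longrightarrow> descent w s" "w \<in> carrier W" "w \<otimes> w = \<one>"
    using omega_longest[OF X] omega_closed[OF X] omega_square[OF X] by (simp_all add: w_def)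
  have commute: "w \<otimes> s \<otimes> w = s" "w \<otimes> s = s \<otimes> w" "\<not> descent w s" if s: "s \<in> Y" "s \<notin> X" for s
  proof -
    have sS: "s \<in> S" using s YS by auto
    define t where "t = w \<otimes> s \<otimes> w"
    have tS: "t \<in> S" using s(1) sub by (auto simp: omega_conj_def t_def w_def)
    have wtw: "w \<otimes> t \<otimes> w = s" using omega_conj_twice[OF X, of s] sS by (simp add: t_def w_def)
    have gen: "generate W X \<subseteq> generate W (insert s X)" by (intro mono_generate) auto
    have "s \<in> generate W (insert s X)" by (auto intro: generate.incl)
    then have "t \<in> generate W (insert s X)"
      using gen w(1) unfolding t_def by (blast intro: generate.eng)
    then have "t \<in> insert s X" using generator_in_parabolic[of "insert s X" t] tS XS sS by auto
    moreover have "t \<notin> X"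
    proof
      assume "t \<in> X"
      then have "s \<in> X" using omega_conj_elem[OF X, of t] wtw by (simp add: w_def)
      then show False using s by simp
    qed
    ultimately have t: "t = s" by simp
    then show "w \<otimes> s \<otimes> w = s" by (simp add: t_def)
    have "w \<otimes> s = w \<otimes> s \<otimes> (w \<otimes> w)" using w(3,4) sS by simp
    also have "\<dots> = t \<otimes> w" using w(3) sS by (simp only: t_def m_assoc m_closed gen_closed)
    finally show "w \<otimes> s = s \<otimes> w" using t by simp
    \<comment> \<open>Otherwise exchange puts \<open>w s\<close>, and hence \<open>s\<close>, into \<open>W\<^sub>X\<close>.\<close>
    show "\<not> descent w s"
    proof
      assume "descent w s"
      obtain xs where xs: "set xs \<subseteq> X" "lprod xs = w"
        using parabolic_reduced_word[OF XS(1) w(1)] by auto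
      then have "set xs \<subseteq> S" using XS by auto
      moreover have "len (lprod xs \<otimes> s) < len (lprod xs)"
        using \<open>descent w s\<close> xs(2) by (simp add: descent_def)
      ultimately obtain ys z zs where ex: "xs = ys @ z # zs" "lprod xs \<otimes> s = lprod (ys @ zs)"
        using sS by (metis exchange)
      then have "w \<otimes> s \<in> generate W X" using xs lprod_in_generate[OF XS(1), of "ys @ zs"] by auto
      then have "w \<otimes> (w \<otimes> s) \<in> generate W X" using w(1) by (blast intro: generate.eng)
      then have "s \<in> generate W X" using w(3,4) sS by (simp flip: m_assoc)
      then show False using generator_in_parabolic[OF XS(1) sS] s(2) by simp
    qed
  qed
  have "(\<forall>s\<in>Y. s \<notin> X) \<or> (\<forall>s\<in>Y. \<not> s \<notin> X)"
  proof (rule irreducible_split[OF YS(2)])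
    fix s t assume st: "s \<in> Y" "t \<in> Y" "s \<notin> X" "\<not> t \<notin> X"
    then have S: "s \<in> S" "t \<in> S" and tX: "t \<in> X" using YS by auto
    have "w \<otimes> t \<otimes> w \<in> X" using omega_conj_elem[OF X tX] by (simp add: w_def)
    moreover have "w \<otimes> t = (w \<otimes> t \<otimes> w) \<otimes> w" using w(3,4) S by (simp add: m_assoc)
    ultimately show "M s t = 2"
      using conjugation_splits[OF w(3) S S(1), of "w \<otimes> t \<otimes> w"] commute(2,3)[OF st(1,3)] w(2)[OF tX] XS
      by auto
  qed
  then show ?thesis
  proof
    assume "\<forall>s\<in>Y. s \<notin> X"
    then have "omega_conj W X Y = (\<lambda>y. y) ` Y"
      unfolding omega_conj_def w_def[symmetric] using commute(1) by (intro image_cong) auto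
    then show ?thesis by simp
  next
    assume "\<forall>s\<in>Y. \<not> s \<notin> X"
    then have "Y \<subseteq> X" by auto
    then show ?thesis using omega_conj_self[OF X] by auto
  qed
qed

end

section \<open>The cactus group\<close>

context coxeter_group
begin

abbreviation C :: "'a set letter list set monoid" where
  "C \<equiv> cactus_group W S M"

abbreviation c :: "'a set \<Rightarrow> 'a set letter list set" where
  "c \<equiv> cactus_gen W S M"

abbreviation R :: "('a set letter list \<times> 'a set letter list) set" where
  "R \<equiv> cactus_relations W S M"

abbreviation E :: "('a set \<times> 'a set) set" where
  "E \<equiv> cactus_equiv W S M"

lemma finite_FI: "finite FI"
proof (rule finite_subset)
  show "FI \<subseteq> Pow S" using FI_D(2) by auto
qed (use finite_S in simp)

lemma finite_R: "finite R"
proof -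
  have "R \<subseteq> (\<lambda>X. ([Gen X, Gen X], [])) ` FI
      \<union> (\<lambda>(X, Y). ([Gen X, Gen Y], [Gen (omega_conj W X Y), Gen X])) ` (FI \<times> FI)
      \<union> (\<lambda>(X, Y). ([Gen Y, Gen X], [Gen X, Gen Y])) ` (FI \<times> FI)"
    by (auto simp: cactus_relations_def Omega0_def Omega1_def)
  then show ?thesis by (rule finite_subset) (use finite_FI in simp)
qed

lemma group_C: "group C"
  unfolding cactus_group_def by (rule group_presented_group)

lemma c_closed: "X \<in> FI \<Longrightarrow> c X \<in> carrier C"
  by (auto simp: cactus_group_def cactus_gen_def carrier_presented_group)

lemma c_generates: "generate C (c ` FI) = carrier C"
  unfolding cactus_group_def cactus_gen_def by (rule presented_group_generated)

lemma c_square: "X \<in> FI \<Longrightarrow> c X \<otimes>\<^bsub>C\<^esub> c X = \<one>\<^bsub>C\<^esub>"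
proof -
  assume X: "X \<in> FI"
  then have "([Gen X, Gen X], []) \<in> R" by (auto simp: cactus_relations_def)
  then have "word_class FI R [Gen X, Gen X] = word_class FI R []"
    using X by (intro word_class_relation) auto
  then show ?thesis
    using X by (simp add: cactus_group_def cactus_gen_def mult_word_class one_presented_group)
qed

lemma c_conj:
  assumes X: "X \<in> FI" and Y: "Y \<in> FI" "Y \<subset> X" "omega_conj W X Y \<in> FI"
  shows "c (omega_conj W X Y) = c X \<otimes>\<^bsub>C\<^esub> c Y \<otimes>\<^bsub>C\<^esub> inv\<^bsub>C\<^esub> c X"
proof -
  interpret C: group C by (rule group_C)
  have "([Gen X, Gen Y], [Gen (omega_conj W X Y), Gen X]) \<in> R"
    using X Y by (auto simp: cactus_relations_def Omega0_def)
  then have "word_class FI R [Gen X, Gen Y] = word_class FI R [Gen (omega_conj W X Y), Gen X]"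
    using X Y by (intro word_class_relation) auto
  then have "c X \<otimes>\<^bsub>C\<^esub> c Y = c (omega_conj W X Y) \<otimes>\<^bsub>C\<^esub> c X"
    using X Y by (simp add: cactus_group_def cactus_gen_def mult_word_class)
  then show ?thesis using c_closed X Y by (simp add: C.m_assoc)
qed

lemma equiv_E: "equiv FI E"
proof (rule equivI)
  let ?E0 = "cactus_equiv0 W S M"
  show "E \<subseteq> FI \<times> FI"
    unfolding cactus_equiv_def by (rule trancl_subset_Sigma) (auto simp: cactus_equiv0_def)
  show "refl_on FI E"
  proof (rule refl_onI)
    fix X assume "X \<in> FI"
    then have "(X, X) \<in> ?E0" using omega_conj_self by (force simp: cactus_equiv0_def)
    then show "(X, X) \<in> E" unfolding cactus_equiv_def by blast
  qed
  have "sym ?E0"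
  proof (rule symI)
    fix Y Z assume "(Y, Z) \<in> ?E0"
    then obtain X where "Y \<in> FI" "Z \<in> FI" "X \<in> FI" "Z = omega_conj W X Y"
      by (auto simp: cactus_equiv0_def)
    then show "(Z, Y) \<in> ?E0"
      using omega_conj_involutive[OF _ FI_D(2), of X Y] by (force simp: cactus_equiv0_def)
  qed
  then show "sym E" unfolding cactus_equiv_def by (rule sym_trancl)
  show "trans E" unfolding cactus_equiv_def by (rule trans_trancl)
qed

text \<open>A nontrivial step from \<open>Z\<close> to \<open>\<omega>\<^sub>X(Z)\<close> has \<open>Z \<subset> X\<close> and preserves cardinality, so that all conjugating
  generators along the chain belong to sets larger than \<open>Y\<close>.  The subgroup \<open>K\<close> records this: the
  induction for generation by a transversal takes for \<open>K\<close> the subgroup generated by the transversal.\<close>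

lemma equivalent_gens_conjugate:
  assumes "(Y, Z) \<in> E"
    and K: "subgroup K C" "\<And>X. X \<in> FI \<Longrightarrow> card Y < card X \<Longrightarrow> c X \<in> K"
  shows "card Z = card Y \<and> (\<exists>k\<in>K. c Z = k \<otimes>\<^bsub>C\<^esub> c Y \<otimes>\<^bsub>C\<^esub> inv\<^bsub>C\<^esub> k)"
proof -
  interpret C: group C by (rule group_C)
  interpret K: subgroup K C by fact
  have Y: "Y \<in> FI" using assms(1) equiv_E by (auto simp: equiv_def)
  define P where "P = (\<lambda>Z. card Z = card Y \<and> (\<exists>k\<in>K. c Z = k \<otimes>\<^bsub>C\<^esub> c Y \<otimes>\<^bsub>C\<^esub> inv\<^bsub>C\<^esub> k))"
  have P_step: "P Z'" if ZZ: "P Z" "(Z, Z') \<in> cactus_equiv0 W S M" for Z Z'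
  proof -
    obtain X where X: "Z \<in> FI" "Z' \<in> FI" "X \<in> FI" "Z' = omega_conj W X Z"
      using ZZ(2) by (auto simp: cactus_equiv0_def)
    obtain k where k: "k \<in> K" "c Z = k \<otimes>\<^bsub>C\<^esub> c Y \<otimes>\<^bsub>C\<^esub> inv\<^bsub>C\<^esub> k" and card: "card Z = card Y"
      using ZZ(1) unfolding P_def by blast
    have card': "card Z' = card Y"
      using card_omega_conj[OF X(3) FI_D(2)[OF X(1)]] card X(4) by simp
    have "Z' = Z \<or> Z \<subset> X"
      using omega_conj_in_FI_cases[OF X(3,1)] FI_D(2)[OF X(2)] X(4) by simp
    then show ?thesis
    proof
      assume "Z' = Z" then show ?thesis using ZZ(1) by simp
    next
      assume sub: "Z \<subset> X"
      have "finite X" using FI_D(2)[OF X(3)] finite_S by (rule finite_subset)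
      then have "card Z < card X" using sub by (rule psubset_card_mono)
      then have "c X \<in> K" using K(2)[OF X(3)] card by simp
      have "c Z' = c X \<otimes>\<^bsub>C\<^esub> c Z \<otimes>\<^bsub>C\<^esub> inv\<^bsub>C\<^esub> c X"
        using c_conj[OF X(3,1) sub] X(2,4) by simp
      also have "\<dots> = (c X \<otimes>\<^bsub>C\<^esub> k) \<otimes>\<^bsub>C\<^esub> c Y \<otimes>\<^bsub>C\<^esub> inv\<^bsub>C\<^esub> (c X \<otimes>\<^bsub>C\<^esub> k)"
        using c_closed[OF X(3)] c_closed[OF Y] k
        by (simp add: C.m_assoc C.inv_mult_group)
      finally show ?thesis using card' \<open>c X \<in> K\<close> k(1) unfolding P_def by blast
    qed
  qed
  have "P Y"
    using c_closed[OF Y] unfolding P_def by (auto intro!: bexI[of _ "\<one>\<^bsub>C\<^esub>"])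
  have "P Z" using assms(1) unfolding cactus_equiv_def
  proof (induction rule: trancl_induct)
    case (base Z)
    then show ?case using P_step[OF \<open>P Y\<close>] by simp
  next
    case (step Z Z')
    show ?case by (rule P_step[OF step.IH step.hyps(2)])
  qed
  then show ?thesis by (simp add: P_def)
qed

text \<open>Descending induction on the cardinality of \<open>Y\<close>: the generator of the representative of \<open>Y\<close> is
  conjugate to \<open>c\<^sub>Y\<close> by an element that lies in the subgroup by the induction hypothesis.\<close>

lemma transversal_generates:
  assumes "transversal FI E \<Lambda>"
  shows "generate C (c ` \<Lambda>) = carrier C"
proof -
  interpret C: group C by (rule group_C)
  have \<Lambda>: "\<Lambda> \<subseteq> FI" using assms by (simp add: transversal_def)
  define K where "K = generate C (c ` \<Lambda>)"
  have cl: "c ` \<Lambda> \<subseteq> carrier C" using \<Lambda> c_closed by auto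
  have K: "subgroup K C" unfolding K_def by (rule C.generate_is_subgroup[OF cl])
  interpret K: subgroup K C by (rule K)
  have card_le: "card X \<le> card S" if "X \<in> FI" for X
    using FI_D(2)[OF that] finite_S by (rule card_mono[rotated])
  have "c Y \<in> K" if "Y \<in> FI" for Y
    using that
  proof (induction "card S - card Y" arbitrary: Y rule: less_induct)
    case less
    have larger: "c X \<in> K" if "X \<in> FI" "card Y < card X" for X
      using less.hyps[OF _ that(1)] that card_le[OF that(1)] by simp
    have "E `` {Y} \<in> FI // E" using less.prems by (rule quotientI)
    with assms have "\<exists>!L. L \<in> \<Lambda> \<and> L \<in> E `` {Y}"
      unfolding transversal_def by (blast dest: bspec)
    then obtain L where L: "L \<in> \<Lambda>" "(Y, L) \<in> E" by blast
    obtain k where k: "k \<in> K" "c L = k \<otimes>\<^bsub>C\<^esub> c Y \<otimes>\<^bsub>C\<^esub> inv\<^bsub>C\<^esub> k"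
      using equivalent_gens_conjugate[OF L(2) K larger] by blast
    have "c L \<in> K" using L(1) by (auto simp: K_def intro: generate.incl)
    moreover have "c Y = inv\<^bsub>C\<^esub> k \<otimes>\<^bsub>C\<^esub> c L \<otimes>\<^bsub>C\<^esub> k"
      unfolding k(2) using k(1) c_closed[OF less.prems] by (simp add: C.m_assoc C.inv_mult_cancel)
    ultimately show ?case using k(1) by simp
  qed
  then have "generate C (c ` FI) \<subseteq> K" by (intro C.generate_subgroup_incl[OF _ K]) auto
  then show ?thesis using c_generates K.subset by (auto simp: K_def)
qed

lemma transversal_presentation:
  assumes "transversal FI E \<Lambda>"
  shows "has_finite_presentation_on C (c ` \<Lambda>)"
proof -
  have \<Lambda>: "\<Lambda> \<subseteq> FI" using assms by (simp add: transversal_def)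
  show ?thesis
    unfolding cactus_group_def
  proof (rule finite_presentation_on_generating_set[OF finite_R])
    show "finite (c ` \<Lambda>)" using finite_subset[OF \<Lambda> finite_FI] by simp
    show "c ` \<Lambda> \<subseteq> carrier (presented_group FI R)"
      using \<Lambda> c_closed unfolding cactus_group_def by auto
    show "generate (presented_group FI R) (c ` \<Lambda>) = carrier (presented_group FI R)"
      using transversal_generates[OF assms] unfolding cactus_group_def .
  qed
qed

text \<open>In \<open>\<int>\<^sub>2\<close> the squares vanish and everything commutes, so \<open>(R\<^sub>2)\<close> is the only relation that
  restricts \<open>h\<close>; it asks for invariance under \<open>\<equiv>\<close>.\<close>

lemma ex_character:
  assumes "\<And>Y Z. (Y, Z) \<in> E \<Longrightarrow> h Y = h Z" "\<And>Y. h Y \<in> {0, 1}"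
  shows "\<exists>\<chi> \<in> hom C (integer_mod_group 2). \<forall>Y\<in>FI. \<chi> (c Y) = h Y"
proof -
  let ?Z2 = "integer_mod_group 2"
  have "h Y \<in> carrier ?Z2" for Y
    using assms(2)[of Y] by (auto simp: carrier_integer_mod_group)
  then have h: "h ` FI \<subseteq> carrier ?Z2" by auto
  have "h (omega_conj W X Y) = h Y" if "X \<in> FI" "Y \<in> FI" "omega_conj W X Y \<in> FI" for X Y
  proof -
    have "(Y, omega_conj W X Y) \<in> cactus_equiv0 W S M"
      using that by (auto simp: cactus_equiv0_def)
    then have "(Y, omega_conj W X Y) \<in> E" unfolding cactus_equiv_def by (rule r_into_trancl)
    then show ?thesis using assms(1) by simp
  qed
  moreover have "(h X + h X mod 2) mod 2 = 0" for X using assms(2)[of X] by auto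
  ultimately have "word_val ?Z2 h u = word_val ?Z2 h v"
    if "(u, v) \<in> R" "u \<in> words FI" "v \<in> words FI" for u v
    using that unfolding cactus_relations_def
    by (auto simp: Omega0_def Omega1_def mod_simps add.commute)
  then obtain \<chi> where \<chi>: "\<chi> \<in> hom (presented_group FI R) ?Z2"
    "\<And>u. u \<in> words FI \<Longrightarrow> \<chi> (word_class FI R u) = word_val ?Z2 h u"
    using presented_group_universal[OF group_integer_mod_group h, of R] by blast
  have "\<chi> (c Y) = h Y" if "Y \<in> FI" for Y
    using \<chi>(2)[of "[Gen Y]"] that assms(2)[of Y] by (auto simp: cactus_gen_def)
  then show ?thesis using \<chi>(1) by (auto simp: cactus_group_def)
qed

lemma involution_classes_C:
  assumes m: "m = card (FI // E)"
  obtains cl \<chi> where "involution_classes C FI c cl m \<chi>"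
proof -
  interpret C: group C by (rule group_C)
  have "E \<subseteq> FI \<times> FI" using equiv_E by (simp add: equiv_def)
  then have "finite (FI // E)" by (rule finite_quotient[OF finite_FI])
  then obtain b where b: "bij_betw b (FI // E) {..<m}"
    unfolding m atLeast0LessThan[symmetric] using ex_bij_betw_finite_nat by blast
  define cl where "cl Y = b (E `` {Y})" for Y
  have cl_eq: "cl Y = cl Z \<longleftrightarrow> (Y, Z) \<in> E" if "Y \<in> FI" "Z \<in> FI" for Y Z
  proof -
    have "cl Y = cl Z \<longleftrightarrow> E `` {Y} = E `` {Z}"
      unfolding cl_def using that by (intro inj_on_eq_iff[OF bij_betw_imp_inj_on[OF b]] quotientI)
    then show ?thesis using eq_equiv_class_iff[OF equiv_E that] by simp
  qed
  have "\<exists>\<chi> \<in> hom C (integer_mod_group 2). \<forall>Y\<in>FI. \<chi> (c Y) = (if cl Y = i then 1 else 0)" for i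
  proof (rule ex_character)
    fix Y Z assume "(Y, Z) \<in> E"
    then have "E `` {Y} = E `` {Z}" by (rule equiv_class_eq[OF equiv_E])
    then show "(if cl Y = i then 1 else 0 :: int) = (if cl Z = i then 1 else 0)" by (simp add: cl_def)
  qed simp
  then have "\<forall>i. \<exists>\<chi>. \<chi> \<in> hom C (integer_mod_group 2) \<and> (\<forall>Y\<in>FI. \<chi> (c Y) = (if cl Y = i then 1 else 0))"
    by blast
  then obtain \<chi> where \<chi>: "\<forall>i. \<chi> i \<in> hom C (integer_mod_group 2) \<and>
      (\<forall>Y\<in>FI. \<chi> i (c Y) = (if cl Y = i then 1 else 0))"
    by (rule choice[THEN exE])
  have "involution_classes C FI c cl m \<chi>"
  proof unfold_locales
    show "c ` FI \<subseteq> carrier C" using c_closed by auto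
    show "generate C (c ` FI) = carrier C" by (rule c_generates)
    show "cl ` FI = {..<m}"
      using bij_betw_imp_surj_on[OF b] by (auto simp: cl_def quotient_def)
    show "\<exists>x\<in>carrier C. c Z = x \<otimes>\<^bsub>C\<^esub> c Y \<otimes>\<^bsub>C\<^esub> inv\<^bsub>C\<^esub> x"
      if "Y \<in> FI" "Z \<in> FI" "cl Y = cl Z" for Y Z
      using equivalent_gens_conjugate[OF _ C.subgroup_self c_closed] cl_eq that by simp
  qed (use \<chi> c_square in auto)
  then show thesis by (rule that)
qed

end

theorem proposition0p2:
  fixes W :: "('a, 'b) monoid_scheme" and S :: "'a set" and M :: "'a \<Rightarrow> 'a \<Rightarrow> enat" and m :: nat
  assumes "coxeter_system W S M"
    and "m = card (finite_irreducible_subsets W S M // cactus_equiv W S M)"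
  shows "abelianisation (cactus_group W S M) \<cong>
           product_group {..<m} (\<lambda>_. integer_mod_group 2) \<and>
         (\<forall>A. A \<subseteq> carrier (cactus_group W S M) \<and>
              generate (cactus_group W S M) A = carrier (cactus_group W S M) \<longrightarrow>
              infinite A \<or> m \<le> card A) \<and>
         (\<forall>\<Lambda>. transversal (finite_irreducible_subsets W S M) (cactus_equiv W S M) \<Lambda> \<longrightarrow>
              has_finite_presentation_on (cactus_group W S M) (cactus_gen W S M ` \<Lambda>))"
proof -
  interpret coxeter_group W S M
    using assms(1) by (intro coxeter_group.intro coxeter_group_axioms.intro)
      (auto simp: coxeter_system_def has_presentation_def)
  obtain cl \<chi> where "involution_classes C FI c cl m \<chi>"
    using assms(2) by (rule involution_classes_C)
  then interpret involution_classes C FI c cl m \<chi> .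
  show ?thesis
    using abelianisation_iso card_generating_set_ge transversal_presentation by simp
qed

end
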